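(* Let $\mathcal H$ be a separable complex Hilbert space, let $p\in\mathbb N$ ($p\ge 1$), and let $\Phi_1,\ldots,\Phi_p\in\mathcal L_{\mathcal H}$ be compact operators such that the operator pencil $\Phi:\mathbb C\to\mathcal L_{\mathcal H}$, $\Phi(z)=\mathrm I-\sum_{j=1}^p z^j\Phi_j$, is noninvertible at $z=1$ and invertible at every other $z$ in the closed unit disk. Let $\Pi_0=\Phi(1)$, $\Pi_1=\Phi^{(1)}(1)$, $\alpha_1=\operatorname{ran}\Pi_0$ and $\beta_1=(\ker\Pi_0)^\perp$. The following four conditions are equivalent. (1) $\Phi(z)^{-1}$ has a simple pole at $z=1$. (2) The operator $\Lambda_1:\beta_1^\perp\to\alpha_1^\perp$ obtained by restricting $\mathrm P_{\alpha_1^\perp}\Pi_1$ to $\beta_1^\perp$ is bijective. (3) $\mathcal H=\alpha_1\oplus\Pi_1\beta_1^\perp$. (4) $\mathcal H=\alpha_1+\Pi_1\beta_1^\perp$. If $\Phi(z)^{-1}$ has a simple pole at $z=1$, then its residue at $z=1$ is $\Upsilon_{-1}=\Lambda_1^{-1}\mathrm P_{\alpha_1^\perp}$.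
   Context: $\mathcal L_{\mathcal H}$ is the Banach space of continuous linear operators on $\mathcal H$ with the operator norm; $\mathrm I$ is the identity; $\Phi^{(k)}$ is the $k$th derivative of $\Phi$. $V^\perp$ denotes orthogonal complement and $\mathrm P_V\in\mathcal L_{\mathcal H}$ the orthogonal projection on a closed subspace $V$. For an operator $A$ and a subspace $V$, $AV=\{A(x):x\in V\}$. For linear subspaces, $V+W=\{v+w:v\in V,w\in W\}$; $\mathcal H=V\oplus W$ means that $\mathcal H=V+W$ and $V\cap W=\{0\}$ (the direct sum need not be orthogonal). $\Phi(z)^{-1}$ admits a Laurent series $\Phi(z)^{-1}=\sum_{k=-d}^\infty(z-1)^k\Upsilon_k$, convergent in $\mathcal L_{\mathcal H}$ on a punctured neighborhood of $1$, with $d\in\mathbb N$, $\Upsilon_k\in\mathcal L_{\mathcal H}$, $\Upsilon_{-d}\neq0$; then $\Phi(z)^{-1}$ has a pole of order $d$ at $z=1$ (simple if $d=1$), and $\Upsilon_{-1}$ is its residue. *)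

theory Defs
  imports "HOL-Analysis.Analysis" "HOL-Library.Set_Algebras"
begin

section \<open>Complex Hilbert spaces\<close>

text \<open>
  The inner product is linear in its first argument. Positivity and definiteness are contained in
  \<open>cinner_self\<close>, completeness in the class \<^class>\<open>banach\<close>, and the real structure
  underlying \<^class>\<open>banach\<close> is the restriction of the complex one by \<open>scaleC_of_real\<close>.
\<close>

class chilbert_space = banach +
  fixes scaleC :: "complex \<Rightarrow> 'a \<Rightarrow> 'a"
    and cinner :: "'a \<Rightarrow> 'a \<Rightarrow> complex"
  assumes scaleC_add_right: "scaleC c (x + y) = scaleC c x + scaleC c y"
    and scaleC_add_left: "scaleC (b + c) x = scaleC b x + scaleC c x"
    and scaleC_scaleC: "scaleC b (scaleC c x) = scaleC (b * c) x"
    and scaleC_of_real: "scaleC (complex_of_real r) x = scaleR r x"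
    and cinner_add_left: "cinner (x + y) z = cinner x z + cinner y z"
    and cinner_scaleC_left: "cinner (scaleC c x) y = c * cinner x y"
    and cinner_commute: "cinner x y = cnj (cinner y x)"
    and cinner_self: "cinner x x = complex_of_real ((norm x)\<^sup>2)"

instantiation complex :: chilbert_space
begin

definition scaleC_complex :: "complex \<Rightarrow> complex \<Rightarrow> complex"
  where "scaleC_complex c x = c * x"

definition cinner_complex :: "complex \<Rightarrow> complex \<Rightarrow> complex"
  where "cinner_complex x y = x * cnj y"

instance
proof
  fix x :: complex
  show "cinner x x = complex_of_real ((norm x)\<^sup>2)"
    by (simp add: cinner_complex_def complex_norm_square[symmetric] del: of_real_power)
qed (auto simp: scaleC_complex_def cinner_complex_def algebra_simps scaleR_conv_of_real)

end

lemma norm_scaleC: "norm (scaleC c x) = norm c * norm (x :: 'a::chilbert_space)"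
proof -
  have "complex_of_real ((norm (scaleC c x))\<^sup>2) = c * cnj (cinner (scaleC c x) x)"
    by (metis cinner_self cinner_scaleC_left cinner_commute)
  also have "\<dots> = (c * cnj c) * complex_of_real ((norm x)\<^sup>2)"
    by (simp add: cinner_scaleC_left cinner_self)
  also have "\<dots> = complex_of_real ((norm c * norm x)\<^sup>2)"
    by (simp add: complex_norm_square[symmetric] power_mult_distrib)
  finally have "(norm (scaleC c x))\<^sup>2 = (norm c * norm x)\<^sup>2"
    using of_real_eq_iff by blast
  then show ?thesis by (simp add: power2_eq_iff_nonneg)
qed

lemma bounded_linear_scaleC: "bounded_linear (scaleC c :: 'a::chilbert_space \<Rightarrow> 'a)"
proof (rule bounded_linear_intro[of _ "norm c"])
  show "scaleC c (scaleR r x) = scaleR r (scaleC c x)" for r and x :: 'a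
    by (simp add: scaleC_of_real[symmetric] scaleC_scaleC mult.commute)
qed (auto simp: scaleC_add_right norm_scaleC mult.commute)

definition orth_compl :: "'a::chilbert_space set \<Rightarrow> 'a set"
  where "orth_compl V = {x. \<forall>v\<in>V. cinner x v = 0}"

definition orth_proj :: "'a::chilbert_space set \<Rightarrow> 'a \<Rightarrow> 'a"
  where "orth_proj V x = (THE y. y \<in> V \<and> x - y \<in> orth_compl V)"

definition direct_sum :: "'a::chilbert_space set \<Rightarrow> 'a set \<Rightarrow> bool"
  where "direct_sum V W \<longleftrightarrow> V + W = UNIV \<and> V \<inter> W = {0}"


section \<open>Bounded complex-linear operators\<close>

text \<open>
  Elements of \<^typ>\<open>'a \<Rightarrow>\<^sub>L 'a\<close> are only real-linear. The Banach space of bounded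
  complex-linear operators is the following subspace; it inherits the operator norm.
\<close>

definition cops :: "('a::chilbert_space \<Rightarrow>\<^sub>L 'a) set"
  where "cops = {A. \<forall>c x. blinfun_apply A (scaleC c x) = scaleC c (blinfun_apply A x)}"

lift_definition scaleC_op :: "complex \<Rightarrow> ('a::chilbert_space \<Rightarrow>\<^sub>L 'a) \<Rightarrow> ('a \<Rightarrow>\<^sub>L 'a)"
  is "\<lambda>c A x. scaleC c (A x)"
  by (rule bounded_linear_compose[OF bounded_linear_scaleC])

definition is_op_inverse :: "('a::chilbert_space \<Rightarrow>\<^sub>L 'a) \<Rightarrow> ('a \<Rightarrow>\<^sub>L 'a) \<Rightarrow> bool"
  where "is_op_inverse A B \<longleftrightarrow>
    B \<in> cops \<and> A o\<^sub>L B = id_blinfun \<and> B o\<^sub>L A = id_blinfun"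

definition op_invertible :: "('a::chilbert_space \<Rightarrow>\<^sub>L 'a) \<Rightarrow> bool"
  where "op_invertible A \<longleftrightarrow> (\<exists>B. is_op_inverse A B)"

definition op_inverse :: "('a::chilbert_space \<Rightarrow>\<^sub>L 'a) \<Rightarrow> ('a \<Rightarrow>\<^sub>L 'a)"
  where "op_inverse A = (THE B. is_op_inverse A B)"

definition compact_op :: "('a::chilbert_space \<Rightarrow>\<^sub>L 'a) \<Rightarrow> bool"
  where "compact_op A \<longleftrightarrow> (\<forall>S. bounded S \<longrightarrow> compact (closure (blinfun_apply A ` S)))"

definition op_ran :: "('a::chilbert_space \<Rightarrow>\<^sub>L 'a) \<Rightarrow> 'a set"
  where "op_ran A = range (blinfun_apply A)"

definition op_ker :: "('a::chilbert_space \<Rightarrow>\<^sub>L 'a) \<Rightarrow> 'a set"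
  where "op_ker A = {x. blinfun_apply A x = 0}"


section \<open>Operator-valued functions of a complex variable\<close>

text \<open>
  Complex differentiability: the Frechet derivative is multiplication by an operator \<open>D\<close>.
\<close>

definition op_deriv :: "(complex \<Rightarrow> 'a::chilbert_space \<Rightarrow>\<^sub>L 'a) \<Rightarrow> complex \<Rightarrow> ('a \<Rightarrow>\<^sub>L 'a)"
  where "op_deriv T z = (THE D. (T has_derivative (\<lambda>h. scaleC_op h D)) (at z))"

text \<open>
  \<open>inverse_laurent T a d U\<close>: on a punctured neighbourhood of \<open>a\<close> the inverse of \<open>T z\<close> exists and
  equals the sum over integers \<open>k \<ge> -d\<close> of \<open>(z - a)^k U k\<close>, convergent in operator norm, where
  \<open>d \<ge> 1\<close> and \<open>U (-d) \<noteq> 0\<close>. The series is indexed by \<open>n = k + d\<close>.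
\<close>

definition inverse_laurent ::
    "(complex \<Rightarrow> 'a::chilbert_space \<Rightarrow>\<^sub>L 'a) \<Rightarrow> complex \<Rightarrow> nat \<Rightarrow> (int \<Rightarrow> 'a \<Rightarrow>\<^sub>L 'a) \<Rightarrow> bool"
  where "inverse_laurent T a d U \<longleftrightarrow>
    d \<ge> 1 \<and> (\<forall>k\<ge>- int d. U k \<in> cops) \<and> U (- int d) \<noteq> 0 \<and>
    (\<exists>r>0. \<forall>z. z \<noteq> a \<and> dist z a < r \<longrightarrow>
       op_invertible (T z) \<and>
       (\<lambda>n. scaleC_op ((z - a) powi (int n - int d)) (U (int n - int d))) sums op_inverse (T z))"

definition inverse_has_pole :: "(complex \<Rightarrow> 'a::chilbert_space \<Rightarrow>\<^sub>L 'a) \<Rightarrow> complex \<Rightarrow> nat \<Rightarrow> bool"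
  where "inverse_has_pole T a d \<longleftrightarrow> (\<exists>U. inverse_laurent T a d U)"

definition pencil :: "nat \<Rightarrow> (nat \<Rightarrow> 'a::chilbert_space \<Rightarrow>\<^sub>L 'a) \<Rightarrow> complex \<Rightarrow> ('a \<Rightarrow>\<^sub>L 'a)"
  where "pencil p C z = id_blinfun - (\<Sum>j=1..p. scaleC_op (z ^ j) (C j))"

end

theory Submission
  imports Defs
begin

text \<open>
  Write \<open>N = ker \<Pi>0\<close>, which is \<open>\<beta>1\<^sup>\<bottom>\<close>, let \<open>P\<close> be the orthogonal projection onto \<open>N\<close>, and expand
  \<open>\<Phi>(1 + w) = \<Pi>0 + w \<Pi>1 + w\<^sup>2 A 2 + \<dots>\<close>. The proof shows that the four conditions, called pole,
  bijectivity, direct sum and sum below, are equivalent to the invertibility of \<open>\<Pi>0 + \<Pi>1 P\<close>.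

  Pole implies sum. The two lowest coefficients of \<open>\<Phi>(z) (z - 1) \<Phi>(z)\<^sup>-\<^sup>1 = (z - 1) I\<close> give
  \<open>\<Pi>0 \<Upsilon>(-1) = 0\<close> and \<open>\<Pi>0 \<Upsilon>(0) + \<Pi>1 \<Upsilon>(-1) = I\<close> (\<open>simple_pole_imp_coefficient_equations\<close>). The first
  says that \<open>\<Upsilon>(-1)\<close> maps into \<open>N\<close>, and the second then exhibits every vector as an element of
  \<open>\<alpha>1 + \<Pi>1 N\<close>. Projecting the second equation onto \<open>\<alpha>1\<^sup>\<bottom>\<close> yields \<open>\<Lambda>1 \<Upsilon>(-1) = P\<^bsub>\<alpha>1\<^sup>\<bottom>\<^esub>\<close>, which is the
  formula for the residue once \<open>\<Lambda>1\<close> is known to be injective.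

  Sum implies invertibility. The operator \<open>\<Pi>0 + \<Pi>1 P\<close> has range \<open>\<alpha>1 + \<Pi>1 N\<close> and differs from the
  identity by a compact operator. By Riesz's argument a surjective operator of this kind is
  injective, with bounded inverse (\<open>surj_compact_perturbation_imp_inverse\<close>,
  \<open>ran_plus_image_ker_imp_inverse\<close>). This takes the place of a comparison of the dimensions of \<open>N\<close>
  and \<open>\<alpha>1\<^sup>\<bottom>\<close>.

  Invertibility implies pole. As \<open>\<Pi>0\<close> vanishes on \<open>N\<close>, one can split off a factor \<open>w\<close> there:
  \<open>\<Phi>(1 + w) = B(w) (I - P + w P)\<close> with a polynomial \<open>B\<close> such that \<open>B(0) = \<Pi>0 + \<Pi>1 P\<close>
  (\<open>factor_out_projection\<close>). Near \<open>0\<close> the inverse of \<open>B(w)\<close> is a power series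
  (\<open>polynomial_inverse_power_series\<close>), and the other factor has the inverse \<open>I - P + w\<^sup>-\<^sup>1 P\<close>
  (\<open>simple_pole_if_invertible\<close>).

  The remaining implications are linear algebra. Invertibility forces every \<open>x\<close> in \<open>N\<close> with
  \<open>\<Pi>1 x\<close> in \<open>\<alpha>1\<close> to be \<open>0\<close>, which makes the sum direct and \<open>\<Lambda>1\<close> injective. As \<open>\<alpha>1\<close> is closed
  (\<open>closed_range_compact_perturbation\<close>), the projections of two vectors onto \<open>\<alpha>1\<^sup>\<bottom>\<close> agree exactly if
  the vectors differ by an element of \<open>\<alpha>1\<close>, and so \<open>\<Lambda>1\<close> is surjective exactly if the sum is the
  whole space.
\<close>

section \<open>Geometry of complex Hilbert spaces\<close>

lemma scaleC_one [simp]: "scaleC 1 (x :: 'a::chilbert_space) = x"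
  using scaleC_of_real[of 1 x] by simp

lemma scaleC_zero_left [simp]: "scaleC 0 (x :: 'a::chilbert_space) = 0"
  using scaleC_of_real[of 0 x] by simp

lemma scaleC_zero_right [simp]: "scaleC c (0 :: 'a::chilbert_space) = 0"
  using norm_scaleC[of c "0::'a"] by simp

lemma scaleC_minus_one: "scaleC (- 1) (x :: 'a::chilbert_space) = - x"
  using scaleC_of_real[of "-1" x] by simp

lemma cinner_zero_left [simp]: "cinner 0 (x :: 'a::chilbert_space) = 0"
  using cinner_scaleC_left[of 0 x x] by simp

lemma cinner_zero_right [simp]: "cinner (x :: 'a::chilbert_space) 0 = 0"
  using cinner_commute[of x 0] by simp

lemma cinner_minus_left: "cinner (- x) (y :: 'a::chilbert_space) = - cinner x y"
  using cinner_scaleC_left[of "-1" x y] by (simp add: scaleC_minus_one)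

lemma cinner_diff_left: "cinner (x - y) (z :: 'a::chilbert_space) = cinner x z - cinner y z"
  using cinner_add_left[of x "- y" z] by (simp add: cinner_minus_left)

lemma cinner_add_right: "cinner x (y + z :: 'a::chilbert_space) = cinner x y + cinner x z"
  by (metis cinner_add_left cinner_commute complex_cnj_add)

lemma cinner_diff_right: "cinner x (y - z :: 'a::chilbert_space) = cinner x y - cinner x z"
  by (metis cinner_diff_left cinner_commute complex_cnj_diff)

lemma cinner_scaleC_right: "cinner x (scaleC c y :: 'a::chilbert_space) = cnj c * cinner x y"
  by (metis cinner_scaleC_left cinner_commute complex_cnj_mult)

lemma parallelogram_law:
  fixes x y :: "'a::chilbert_space"
  shows "(norm (x + y))\<^sup>2 + (norm (x - y))\<^sup>2 = 2 * (norm x)\<^sup>2 + 2 * (norm y)\<^sup>2"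
proof -
  have "complex_of_real ((norm (x + y))\<^sup>2 + (norm (x - y))\<^sup>2)
      = complex_of_real (2 * (norm x)\<^sup>2 + 2 * (norm y)\<^sup>2)"
    by (simp only: of_real_add of_real_mult cinner_self[symmetric])
      (simp add: cinner_add_left cinner_add_right cinner_diff_left cinner_diff_right)
  then show ?thesis using of_real_eq_iff by blast
qed

lemma norm_diff_orthogonal:
  fixes x y :: "'a::chilbert_space"
  assumes "cinner x y = 0"
  shows "(norm (x - y))\<^sup>2 = (norm x)\<^sup>2 + (norm y)\<^sup>2"
proof -
  have "cinner y x = 0" using assms cinner_commute[of y x] by simp
  then have "complex_of_real ((norm (x - y))\<^sup>2) = complex_of_real ((norm x)\<^sup>2 + (norm y)\<^sup>2)"
    by (simp only: of_real_add cinner_self[symmetric])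
      (simp add: assms cinner_diff_left cinner_diff_right)
  then show ?thesis using of_real_eq_iff by blast
qed

lemma norm_le_norm_diff_orthogonal:
  fixes x y :: "'a::chilbert_space"
  assumes "cinner x y = 0"
  shows "norm x \<le> norm (x - y)"
  by (rule power2_le_imp_le) (simp_all add: norm_diff_orthogonal[OF assms])

definition csubspace :: "'a::chilbert_space set \<Rightarrow> bool"
  where "csubspace V \<longleftrightarrow> 0 \<in> V \<and> (\<forall>x\<in>V. \<forall>y\<in>V. x + y \<in> V) \<and> (\<forall>c. \<forall>x\<in>V. scaleC c x \<in> V)"

lemma csubspaceD:
  assumes "csubspace V"
  shows "0 \<in> V" "x \<in> V \<Longrightarrow> y \<in> V \<Longrightarrow> x + y \<in> V" "x \<in> V \<Longrightarrow> scaleC c x \<in> V"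
    "x \<in> V \<Longrightarrow> y \<in> V \<Longrightarrow> x - y \<in> V" "x \<in> V \<Longrightarrow> scaleR r x \<in> V"
proof -
  show *: "0 \<in> V" "\<And>x y. x \<in> V \<Longrightarrow> y \<in> V \<Longrightarrow> x + y \<in> V" "\<And>c x. x \<in> V \<Longrightarrow> scaleC c x \<in> V"
    using assms by (auto simp: csubspace_def)
  show "x - y \<in> V" if "x \<in> V" "y \<in> V"
    using *(2)[OF that(1) *(3)[OF that(2), of "-1"]] by (simp add: scaleC_minus_one)
  show "scaleR r x \<in> V" if "x \<in> V"
    using *(3)[OF that, of "complex_of_real r"] by (simp add: scaleC_of_real)
qed

lemma csubspace_orth_compl: "csubspace (orth_compl V)"
  by (simp add: csubspace_def orth_compl_def cinner_add_left cinner_scaleC_left)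

lemma orth_compl_Int: "x \<in> V \<Longrightarrow> x \<in> orth_compl V \<Longrightarrow> x = 0"
  using cinner_self[of x] by (auto simp: orth_compl_def)

lemma subset_orth_compl_orth_compl: "V \<subseteq> orth_compl (orth_compl V)"
proof
  fix x assume "x \<in> V"
  then have "cinner x v = 0" if "v \<in> orth_compl V" for v
    using that cinner_commute[of x v] by (simp add: orth_compl_def)
  then show "x \<in> orth_compl (orth_compl V)" by (simp add: orth_compl_def)
qed

text \<open>
  A minimizing sequence for the distance to \<open>V\<close> is Cauchy by the parallelogram law, because
  midpoints of elements of \<open>V\<close> are no closer than the infimum.
\<close>

lemma nearest_point_exists:
  fixes x :: "'a::chilbert_space"
  assumes V: "csubspace V" and cl: "closed V"
  obtains v where "v \<in> V" "\<And>u. u \<in> V \<Longrightarrow> norm (x - v) \<le> norm (x - u)"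
proof -
  define d where "d = (INF v\<in>V. norm (x - v))"
  have bdd: "bdd_below ((\<lambda>v. norm (x - v)) ` V)" by (rule bdd_belowI[of _ 0]) auto
  have ne: "V \<noteq> {}" using csubspaceD(1)[OF V] by auto
  have d_le: "d \<le> norm (x - v)" if "v \<in> V" for v
    unfolding d_def using bdd that by (rule cINF_lower)
  have d0: "0 \<le> d" unfolding d_def using ne by (rule cINF_greatest) simp
  have "\<exists>v\<in>V. norm (x - v) < d + 1 / real (Suc n)" for n
  proof -
    have "(INF v\<in>V. norm (x - v)) < d + 1 / real (Suc n)" by (simp add: d_def)
    then show ?thesis using cINF_less_iff[OF ne bdd] by simp
  qed
  then obtain v where v: "\<And>n. v n \<in> V" "\<And>n. norm (x - v n) < d + 1 / real (Suc n)" by metis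
  have close: "(norm (v m - v n))\<^sup>2 \<le> (8 * d + 4) * (1 / real (Suc N))" if "m \<ge> N" "n \<ge> N" for m n N
  proof -
    define e where "e = 1 / real (Suc N)"
    have e: "0 \<le> e" "e \<le> 1" by (auto simp: e_def divide_simps)
    have sq: "(norm (x - v k))\<^sup>2 \<le> (d + e)\<^sup>2" if "k \<ge> N" for k
    proof (rule power_mono)
      have "1 / real (Suc k) \<le> e" using that by (simp add: e_def divide_simps)
      then show "norm (x - v k) \<le> d + e" using v(2)[of k] by linarith
    qed simp
    have "scaleR (1/2) (v m + v n) \<in> V" by (intro csubspaceD[OF V] v)
    then have "d \<le> norm (x - scaleR (1/2) (v m + v n))" by (rule d_le)
    also have "x - scaleR (1/2) (v m + v n) = scaleR (1/2) ((x - v m) + (x - v n))"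
      by (simp add: algebra_simps flip: scaleR_add_left)
    finally have "2 * d \<le> norm ((x - v m) + (x - v n))" by simp
    then have "4 * d\<^sup>2 \<le> (norm ((x - v m) + (x - v n)))\<^sup>2"
      using power_mono[of "2 * d" _ 2] d0 by (simp add: power_mult_distrib)
    moreover have "norm (v m - v n) = norm ((x - v m) - (x - v n))" by (simp add: norm_minus_commute)
    ultimately have "(norm (v m - v n))\<^sup>2 \<le> 4 * (d + e)\<^sup>2 - 4 * d\<^sup>2"
      using parallelogram_law[of "x - v m" "x - v n"] sq[OF that(1)] sq[OF that(2)] by simp
    also have "\<dots> = 8 * d * e + 4 * (e * e)" by (simp add: power2_eq_square algebra_simps)
    also have "\<dots> \<le> 8 * d * e + 4 * (1 * e)" using e by (intro add_mono mult_left_mono mult_right_mono) auto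
    finally show ?thesis unfolding e_def[symmetric] by (simp add: algebra_simps)
  qed
  have "Cauchy v"
  proof (rule metric_CauchyI)
    fix \<epsilon> :: real assume \<epsilon>: "\<epsilon> > 0"
    have "(\<lambda>N. (8 * d + 4) * (1 / real (Suc N))) \<longlonglongrightarrow> (8 * d + 4) * 0"
      by (intro tendsto_intros LIMSEQ_Suc[OF lim_1_over_n])
    then have "\<forall>\<^sub>F N in sequentially. (8 * d + 4) * (1 / real (Suc N)) < \<epsilon>\<^sup>2"
      using \<epsilon> by (intro order_tendstoD) auto
    then obtain N where N: "(8 * d + 4) * (1 / real (Suc N)) < \<epsilon>\<^sup>2"
      by (auto simp: eventually_sequentially)
    show "\<exists>M. \<forall>m\<ge>M. \<forall>n\<ge>M. dist (v m) (v n) < \<epsilon>"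
    proof (intro exI[of _ N] allI impI)
      fix m n assume "N \<le> m" "N \<le> n"
      then have "(norm (v m - v n))\<^sup>2 < \<epsilon>\<^sup>2" using close[of N m n] N by linarith
      then show "dist (v m) (v n) < \<epsilon>" using \<epsilon> by (simp add: dist_norm power_less_imp_less_base)
    qed
  qed
  then obtain l where l: "v \<longlonglongrightarrow> l" using Cauchy_convergent convergent_def by blast
  have "l \<in> V" using closed_sequentially[OF cl _ l] v(1) by blast
  moreover have "norm (x - l) \<le> d"
  proof (rule LIMSEQ_le)
    show "(\<lambda>n. norm (x - v n)) \<longlonglongrightarrow> norm (x - l)" by (intro tendsto_intros l)
    show "(\<lambda>n. d + 1 / real (Suc n)) \<longlonglongrightarrow> d"
      using tendsto_add[OF tendsto_const LIMSEQ_Suc[OF lim_1_over_n], of d] by simp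
    show "\<exists>N. \<forall>n\<ge>N. norm (x - v n) \<le> d + 1 / real (Suc n)" using v(2) less_imp_le by blast
  qed
  ultimately show thesis using that[of l] d_le by (meson order_trans)
qed

lemma orthogonal_decomposition:
  fixes x :: "'a::chilbert_space"
  assumes V: "csubspace V" and cl: "closed V"
  obtains v where "v \<in> V" "x - v \<in> orth_compl V"
proof -
  obtain v where v: "v \<in> V" "\<And>u. u \<in> V \<Longrightarrow> norm (x - v) \<le> norm (x - u)"
    using nearest_point_exists[OF V cl] by metis
  have "cinner (x - v) u = 0" if u: "u \<in> V" for u
  proof (cases "u = 0")
    case False
    (* Subtracting from x - v its component along u must not decrease the norm. *)
    define y where "y = x - v"
    define a where "a = scaleC (cinner y u / cinner u u) u"
    have uu: "cinner u u \<noteq> 0" using False cinner_self[of u] by simp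
    have "cinner (y - a) u = 0" by (simp add: a_def cinner_diff_left cinner_scaleC_left uu)
    then have "cinner (y - a) a = 0" by (simp add: a_def cinner_scaleC_right)
    then have "cinner (y - a) (- a) = 0" using cinner_diff_right[of "y - a" 0 a] by simp
    from norm_diff_orthogonal[OF this] have "(norm y)\<^sup>2 = (norm (y - a))\<^sup>2 + (norm a)\<^sup>2" by simp
    moreover have "v + a \<in> V" using v(1) u by (simp add: a_def csubspaceD(2,3)[OF V])
    then have "norm y \<le> norm (y - a)" using v(2)[of "v + a"] by (simp add: y_def algebra_simps)
    then have "(norm y)\<^sup>2 \<le> (norm (y - a))\<^sup>2" by (intro power_mono) auto
    ultimately have "a = 0" by simp
    then have "norm (cinner y u / cinner u u) * norm u = 0" by (metis a_def norm_scaleC norm_zero)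
    then show ?thesis using False uu by (simp add: y_def)
  qed simp
  then show thesis using that v(1) by (simp add: orth_compl_def)
qed

lemma orth_proj_eqI:
  assumes V: "csubspace V" and y: "y \<in> V" "x - y \<in> orth_compl V"
  shows "orth_proj V x = y"
  unfolding orth_proj_def
proof (rule the_equality)
  fix z assume z: "z \<in> V \<and> x - z \<in> orth_compl V"
  have "(x - y) - (x - z) \<in> orth_compl V"
    using y z by (blast intro: csubspaceD(4)[OF csubspace_orth_compl])
  then have "z - y \<in> orth_compl V" by simp
  moreover have "z - y \<in> V" using y z by (blast intro: csubspaceD(4)[OF V])
  ultimately show "z = y" using orth_compl_Int by force
qed (use y in blast)

lemma orth_proj_in:
  assumes "csubspace V" "closed V"
  shows "orth_proj V x \<in> V" "x - orth_proj V x \<in> orth_compl V"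
proof -
  obtain v where "v \<in> V" "x - v \<in> orth_compl V"
    using orthogonal_decomposition[OF assms] by blast
  then show "orth_proj V x \<in> V" "x - orth_proj V x \<in> orth_compl V"
    using orth_proj_eqI[OF assms(1), of v x] by auto
qed

lemma orth_compl_orth_compl:
  assumes V: "csubspace V" "closed V"
  shows "orth_compl (orth_compl V) = V"
proof
  show "orth_compl (orth_compl V) \<subseteq> V"
  proof
    fix x assume x: "x \<in> orth_compl (orth_compl V)"
    have "x - orth_proj V x \<in> orth_compl (orth_compl V)"
      using x orth_proj_in(1)[OF V] subset_orth_compl_orth_compl
      by (intro csubspaceD(4)[OF csubspace_orth_compl]) blast+
    then have "x - orth_proj V x = 0" using orth_proj_in(2)[OF V] orth_compl_Int by blast
    then show "x \<in> V" using orth_proj_in(1)[OF V, of x] by simp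
  qed
qed (rule subset_orth_compl_orth_compl)

lemma orth_proj_orth_compl:
  assumes V: "csubspace V" "closed V"
  shows "orth_proj (orth_compl V) x = x - orth_proj V x"
  using orth_proj_in[OF V, of x] subset_orth_compl_orth_compl
  by (intro orth_proj_eqI csubspace_orth_compl) auto

lemma bounded_linear_orth_proj:
  assumes V: "csubspace V" "closed V"
  shows "bounded_linear (orth_proj V)"
    and "orth_proj V (scaleC c x) = scaleC c (orth_proj V x)"
proof -
  note i = orth_proj_in[OF V]
  have scaleC: "orth_proj V (scaleC c x) = scaleC c (orth_proj V x)" for c x
  proof (rule orth_proj_eqI[OF V(1)])
    have "scaleC c x - scaleC c (orth_proj V x) = scaleC c (x - orth_proj V x)"
      by (simp add: bounded_linear.linear bounded_linear_scaleC linear_diff)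
    then show "scaleC c x - scaleC c (orth_proj V x) \<in> orth_compl V"
      by (simp add: i csubspaceD(3)[OF csubspace_orth_compl])
  qed (simp add: i csubspaceD(3)[OF V(1)])
  then show "orth_proj V (scaleC c x) = scaleC c (orth_proj V x)" .
  show "bounded_linear (orth_proj V)"
  proof (rule bounded_linear_intro[of _ 1])
    show "orth_proj V (x + y) = orth_proj V x + orth_proj V y" for x y
    proof (rule orth_proj_eqI[OF V(1)])
      have "x + y - (orth_proj V x + orth_proj V y) = (x - orth_proj V x) + (y - orth_proj V y)" by simp
      then show "x + y - (orth_proj V x + orth_proj V y) \<in> orth_compl V"
        by (metis i(2) csubspaceD(2)[OF csubspace_orth_compl])
    qed (simp add: i csubspaceD(2)[OF V(1)])
    show "orth_proj V (scaleR r x) = scaleR r (orth_proj V x)" for r x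
      using scaleC[of "complex_of_real r" x] by (simp add: scaleC_of_real)
    show "norm (orth_proj V x) \<le> norm x * 1" for x
    proof -
      have "cinner (x - orth_proj V x) (orth_proj V x) = 0"
        using i[of x] by (simp add: orth_compl_def)
      then have "cinner (orth_proj V x) (- (x - orth_proj V x)) = 0"
        by (metis cinner_commute cinner_minus_left complex_cnj_zero minus_zero)
      from norm_le_norm_diff_orthogonal[OF this] show ?thesis by simp
    qed
  qed
qed

section \<open>Complex scalars and complex-linear operators\<close>

lemma norm_scaleC_op_le: "norm (scaleC_op c A) \<le> norm c * norm A"
proof (rule norm_blinfun_bound)
  show "norm (scaleC_op c A x) \<le> norm c * norm A * norm x" for x
    using mult_left_mono[OF norm_blinfun[of A x], of "norm c"]
    by (simp add: scaleC_op.rep_eq norm_scaleC mult.assoc)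
qed simp

lemma bounded_bilinear_scaleC_op: "bounded_bilinear (scaleC_op :: complex \<Rightarrow> ('a::chilbert_space \<Rightarrow>\<^sub>L 'a) \<Rightarrow> _)"
proof
  fix c b :: complex and A C :: "'a \<Rightarrow>\<^sub>L 'a" and r :: real
  show "scaleC_op (c + b) A = scaleC_op c A + scaleC_op b A"
    by (rule blinfun_eqI) (simp add: scaleC_op.rep_eq blinfun.add_left scaleC_add_left)
  show "scaleC_op c (A + C) = scaleC_op c A + scaleC_op c C"
    by (rule blinfun_eqI) (simp add: scaleC_op.rep_eq blinfun.add_left scaleC_add_right)
  show "scaleC_op (r *\<^sub>R c) A = r *\<^sub>R scaleC_op c A"
    by (rule blinfun_eqI)
      (simp add: scaleC_op.rep_eq blinfun.scaleR_left scaleC_of_real[where 'a = 'a, symmetric] scaleC_scaleC scaleR_conv_of_real)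
  show "scaleC_op c (r *\<^sub>R A) = r *\<^sub>R scaleC_op c A"
    by (rule blinfun_eqI)
      (simp add: scaleC_op.rep_eq blinfun.scaleR_left scaleC_of_real[symmetric] scaleC_scaleC mult.commute)
  show "\<exists>K. \<forall>(c::complex) (A::'a \<Rightarrow>\<^sub>L 'a). norm (scaleC_op c A) \<le> norm c * norm A * K"
    by (intro exI[of _ 1]) (simp add: norm_scaleC_op_le)
qed

interpretation scaleC_op: bounded_bilinear scaleC_op
  by (rule bounded_bilinear_scaleC_op)

lemma scaleC_op_one [simp]: "scaleC_op 1 A = A"
  by (rule blinfun_eqI) (simp add: scaleC_op.rep_eq)

lemma scaleC_op_scaleC_op [simp]: "scaleC_op b (scaleC_op c A) = scaleC_op (b * c) A"
  by (rule blinfun_eqI) (simp add: scaleC_op.rep_eq scaleC_scaleC)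

lemma norm_scaleC_op: "norm (scaleC_op c A) = norm c * norm A"
proof (rule antisym)
  show "norm (scaleC_op c A) \<le> norm c * norm A" by (rule norm_scaleC_op_le)
  show "norm c * norm A \<le> norm (scaleC_op c A)"
  proof (cases "c = 0")
    case False
    have "norm A \<le> norm (1 / c) * norm (scaleC_op c A)"
      using norm_scaleC_op_le[of "1 / c" "scaleC_op c A"] False by simp
    then show ?thesis using False by (simp add: norm_divide field_simps)
  qed simp
qed

lemma scaleC_op_compose_left: "scaleC_op c A o\<^sub>L B = scaleC_op c (A o\<^sub>L B)"
  by (rule blinfun_eqI) (simp add: scaleC_op.rep_eq)

lemma scaleC_op_compose_right: "A \<in> cops \<Longrightarrow> A o\<^sub>L scaleC_op c B = scaleC_op c (A o\<^sub>L B)"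
  by (rule blinfun_eqI) (simp add: scaleC_op.rep_eq cops_def)

lemma copsD: "A \<in> cops \<Longrightarrow> blinfun_apply A (scaleC c x) = scaleC c (blinfun_apply A x)"
  by (simp add: cops_def)

lemma cops_zero [simp]: "0 \<in> cops"
  and cops_id [simp]: "id_blinfun \<in> cops"
  by (simp_all add: cops_def)

lemma cops_add: "A \<in> cops \<Longrightarrow> B \<in> cops \<Longrightarrow> A + B \<in> cops"
  by (simp add: cops_def blinfun.add_left scaleC_add_right)

lemma cops_uminus: "A \<in> cops \<Longrightarrow> - A \<in> cops"
  by (simp add: cops_def blinfun.minus_left linear_neg[OF bounded_linear.linear[OF bounded_linear_scaleC]])

lemma cops_diff: "A \<in> cops \<Longrightarrow> B \<in> cops \<Longrightarrow> A - B \<in> cops"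
  using cops_add[OF _ cops_uminus, of A B] by simp

lemma cops_compose: "A \<in> cops \<Longrightarrow> B \<in> cops \<Longrightarrow> A o\<^sub>L B \<in> cops"
  by (simp add: cops_def)

lemma cops_scaleC_op: "A \<in> cops \<Longrightarrow> scaleC_op c A \<in> cops"
  by (simp add: cops_def scaleC_op.rep_eq scaleC_scaleC mult.commute)

lemma cops_sum: "(\<And>i. i \<in> I \<Longrightarrow> A i \<in> cops) \<Longrightarrow> sum A I \<in> cops"
  by (induction I rule: infinite_finite_induct) (auto intro: cops_add)

text \<open>The inverse of a complex-linear bijection is automatically complex-linear.\<close>

lemma is_op_inverseI:
  assumes A: "A \<in> cops" and B: "A o\<^sub>L B = id_blinfun" "B o\<^sub>L A = id_blinfun"
  shows "is_op_inverse A B"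
proof -
  have AB: "A (B x) = x" and BA: "B (A x) = x" for x
    using B by (metis blinfun_apply_blinfun_compose blinfun_apply_id_blinfun)+
  have "B (scaleC c x) = scaleC c (B x)" for c x
    using BA[of "scaleC c (B x)"] by (simp add: copsD[OF A] AB)
  then show ?thesis using B by (simp add: is_op_inverse_def cops_def)
qed

lemma op_inverse_eqI:
  assumes "is_op_inverse A B"
  shows "op_inverse A = B"
  unfolding op_inverse_def
proof (rule the_equality)
  show "is_op_inverse A B" by (rule assms)
next
  fix C assume "is_op_inverse A C"
  then show "C = B" using assms unfolding is_op_inverse_def
    by (intro blinfun_eqI) (metis blinfun_apply_blinfun_compose blinfun_apply_id_blinfun)
qed

lemma is_op_inverse_op_inverse: "op_invertible A \<Longrightarrow> is_op_inverse A (op_inverse A)"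
  unfolding op_invertible_def using op_inverse_eqI by blast

section \<open>Operator-valued power series\<close>

text \<open>
  Since one factor is a polynomial, the Cauchy product is a finite sum of shifted copies of the
  series. Every comparison of coefficients below goes through this identity.
\<close>

lemma polynomial_times_power_series:
  fixes A E :: "nat \<Rightarrow> 'a::chilbert_space \<Rightarrow>\<^sub>L 'a"
  assumes A: "\<And>i. A i \<in> cops" "\<And>i. i > m \<Longrightarrow> A i = 0"
    and E: "(\<lambda>n. scaleC_op (w ^ n) (E n)) sums S"
  shows "(\<lambda>n. scaleC_op (w ^ n) (\<Sum>i\<le>n. A i o\<^sub>L E (n - i))) sums ((\<Sum>i\<le>m. scaleC_op (w ^ i) (A i)) o\<^sub>L S)"
proof -
  let ?f = "\<lambda>i n. if i \<le> n then scaleC_op (w ^ n) (A i o\<^sub>L E (n - i)) else 0"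
  have "?f i sums (scaleC_op (w ^ i) (A i) o\<^sub>L S)" for i
  proof -
    have "(\<lambda>n. scaleC_op (w ^ i) (A i) o\<^sub>L scaleC_op (w ^ n) (E n)) sums (scaleC_op (w ^ i) (A i) o\<^sub>L S)"
      by (rule bounded_linear.sums[OF bounded_bilinear.bounded_linear_right[OF bounded_bilinear_blinfun_compose] E])
    then have "(\<lambda>n. ?f i (n + i)) sums (scaleC_op (w ^ i) (A i) o\<^sub>L S)"
      by (simp add: scaleC_op_compose_left scaleC_op_compose_right[OF A(1)] power_add mult.commute)
    then show ?thesis by (subst (asm) sums_zero_iff_shift) auto
  qed
  then have "(\<lambda>n. \<Sum>i\<le>m. ?f i n) sums (\<Sum>i\<le>m. scaleC_op (w ^ i) (A i) o\<^sub>L S)"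
    by (rule sums_sum)
  moreover have "(\<Sum>i\<le>m. ?f i n) = scaleC_op (w ^ n) (\<Sum>i\<le>n. A i o\<^sub>L E (n - i))" for n
  proof -
    have "(\<Sum>i\<le>m. ?f i n) = (\<Sum>i\<in>{..m} \<inter> {..n}. scaleC_op (w ^ n) (A i o\<^sub>L E (n - i)))"
      by (rule sum.mono_neutral_cong_right) auto
    also have "\<dots> = (\<Sum>i\<le>n. scaleC_op (w ^ n) (A i o\<^sub>L E (n - i)))"
    proof (rule sum.mono_neutral_left)
      show "\<forall>i\<in>{..n} - {..m} \<inter> {..n}. scaleC_op (w ^ n) (A i o\<^sub>L E (n - i)) = 0"
        by (auto simp: A(2) scaleC_op.zero_right min_def split: if_splits)
    qed auto
    finally show ?thesis by (simp add: scaleC_op.sum_right)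
  qed
  ultimately show ?thesis
    by (simp add: bounded_bilinear.sum_left[OF bounded_bilinear_blinfun_compose])
qed

text \<open>
  The terms of the series at one fixed point are bounded, so for smaller \<open>w\<close> the tail is dominated
  by a geometric series of size proportional to \<open>norm w\<close>. The values at \<open>w = 0\<close> are excluded because
  the lemma is applied to Laurent expansions, which converge in punctured discs.
\<close>

lemma power_series_tendsto_constant_coefficient:
  fixes c :: "nat \<Rightarrow> 'a::chilbert_space \<Rightarrow>\<^sub>L 'a"
  assumes r: "r > 0" and s: "\<And>w. w \<noteq> 0 \<Longrightarrow> norm w < r \<Longrightarrow> (\<lambda>n. scaleC_op (w ^ n) (c n)) sums s w"
  shows "(s \<longlongrightarrow> c 0) (at 0)"
proof -
  define \<rho> where "\<rho> = r / 2"
  have \<rho>: "\<rho> > 0" "\<rho> < r" using r by (auto simp: \<rho>_def)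
  have "Bseq (\<lambda>n. scaleC_op (complex_of_real \<rho> ^ n) (c n))"
    using s[of "complex_of_real \<rho>"] \<rho>
    by (intro convergent_imp_Bseq convergentI[of _ 0] summable_LIMSEQ_zero sums_summable) auto
  then obtain M where M: "M > 0" "\<And>n. norm (scaleC_op (complex_of_real \<rho> ^ n) (c n)) \<le> M"
    by (auto simp: Bseq_def)
  have c: "norm (c n) \<le> M / \<rho> ^ n" for n
    using M(2)[of n] \<rho> by (simp add: norm_scaleC_op norm_power field_simps)
  have bound: "norm (s w - c 0) \<le> (2 * M / \<rho>) * norm w" if w: "w \<noteq> 0" "norm w < \<rho> / 2" for w
  proof -
    define q where "q = norm w / \<rho>"
    have q: "0 \<le> q" "q < 1 / 2" using w \<rho> by (auto simp: q_def field_simps)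
    have "(\<lambda>n. scaleC_op (w ^ Suc n) (c (Suc n))) sums (s w - c 0)"
      using s[of w] w \<rho> by (subst sums_Suc_iff) auto
    moreover have "(\<lambda>n. M * q * q ^ n) sums (M * q * (1 / (1 - q)))"
      using q by (intro sums_mult geometric_sums) auto
    moreover have "norm (scaleC_op (w ^ Suc n) (c (Suc n))) \<le> M * q * q ^ n" for n
    proof -
      have "norm (scaleC_op (w ^ Suc n) (c (Suc n))) \<le> norm w ^ Suc n * (M / \<rho> ^ Suc n)"
        unfolding norm_scaleC_op norm_power by (intro mult_left_mono c) simp
      also have "\<dots> = M * q * q ^ n" by (simp add: q_def power_divide)
      finally show ?thesis .
    qed
    ultimately have "norm (s w - c 0) \<le> M * q * (1 / (1 - q))" by (rule norm_sums_le)
    also have "\<dots> \<le> M * q * 2" using q M(1) by (intro mult_left_mono) (auto simp: field_simps)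
    finally show ?thesis by (simp add: q_def mult_ac)
  qed
  have "((\<lambda>w. s w - c 0) \<longlongrightarrow> 0) (at 0)"
  proof (rule Lim_null_comparison)
    show "\<forall>\<^sub>F w in at 0. norm (s w - c 0) \<le> (2 * M / \<rho>) * norm w"
      unfolding eventually_at using bound \<rho> by (intro exI[of _ "\<rho> / 2"]) (auto simp: dist_norm)
    show "((\<lambda>w::complex. (2 * M / \<rho>) * norm w) \<longlongrightarrow> 0) (at 0)"
      by (intro tendsto_mult_right_zero tendsto_norm_zero tendsto_ident_at)
  qed
  then show ?thesis by (rule LIM_zero_cancel)
qed

lemma power_series_eq_linear_imp_coefficients:
  fixes c :: "nat \<Rightarrow> 'a::chilbert_space \<Rightarrow>\<^sub>L 'a"
  assumes r: "r > 0"
    and s: "\<And>w. w \<noteq> 0 \<Longrightarrow> norm w < r \<Longrightarrow> (\<lambda>n. scaleC_op (w ^ n) (c n)) sums scaleC_op w D"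
  shows "c 0 = 0" and "c 1 = D"
proof -
  have "((\<lambda>w. scaleC_op w D) \<longlongrightarrow> scaleC_op 0 D) (at 0)"
    by (intro bounded_linear.tendsto[OF scaleC_op.bounded_linear_left] tendsto_ident_at)
  then show c0: "c 0 = 0"
    using power_series_tendsto_constant_coefficient[OF r s] tendsto_unique[OF at_neq_bot] scaleC_op.zero_left
    by metis
  have "(\<lambda>n. scaleC_op (w ^ n) (c (Suc n))) sums D" if w: "w \<noteq> 0" "norm w < r" for w
  proof -
    have "(\<lambda>n. scaleC_op (w ^ Suc n) (c (Suc n))) sums scaleC_op w D"
      using s[OF w] c0 by (subst sums_Suc_iff) auto
    from bounded_linear.sums[OF scaleC_op.bounded_linear_right this, of "1 / w"]
    show ?thesis using w by simp
  qed
  from power_series_tendsto_constant_coefficient[OF r this]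
  show "c 1 = D" using tendsto_unique[OF at_neq_bot _ tendsto_const] by (metis One_nat_def)
qed

text \<open>
  The coefficients of the reciprocal of a power series with coefficients \<open>B\<close> and \<open>B 0\<close> inverse to
  \<open>G\<close>: the recursion solves the convolution equations one degree at a time.
\<close>

fun inverse_coeffs ::
    "('a::chilbert_space \<Rightarrow>\<^sub>L 'a) \<Rightarrow> (nat \<Rightarrow> 'a \<Rightarrow>\<^sub>L 'a) \<Rightarrow> nat \<Rightarrow> ('a \<Rightarrow>\<^sub>L 'a)"
  where "inverse_coeffs G B n =
    (if n = 0 then G else - (G o\<^sub>L (\<Sum>i=1..n. B i o\<^sub>L inverse_coeffs G B (n - i))))"

declare inverse_coeffs.simps [simp del]

lemma inverse_coeffs_in_cops:
  assumes "G \<in> cops" "\<And>i. B i \<in> cops"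
  shows "inverse_coeffs G B n \<in> cops"
proof (induction n rule: less_induct)
  case (less n)
  show ?case
    by (subst inverse_coeffs.simps) (auto intro!: cops_uminus cops_compose cops_sum assms less.IH)
qed

lemma inverse_coeffs_convolution:
  assumes "B 0 o\<^sub>L G = id_blinfun"
  shows "(\<Sum>i\<le>n. B i o\<^sub>L inverse_coeffs G B (n - i)) = (if n = 0 then id_blinfun else 0)"
proof (cases "n = 0")
  case False
  let ?R = "\<Sum>i=1..n. B i o\<^sub>L inverse_coeffs G B (n - i)"
  have "B 0 o\<^sub>L inverse_coeffs G B n = - ((B 0 o\<^sub>L G) o\<^sub>L ?R)"
    using False by (subst inverse_coeffs.simps) (auto intro!: blinfun_eqI simp: blinfun.minus_left blinfun.minus_right)
  also have "\<dots> = - ?R" by (simp add: assms) (auto intro!: blinfun_eqI simp: blinfun.minus_left)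
  finally have "(B 0 o\<^sub>L inverse_coeffs G B n) + ?R = 0" by (simp only: eq_neg_iff_add_eq_0)
  moreover have "{..n} = insert 0 {1..n}" by auto
  ultimately show ?thesis using False by simp
qed (simp add: assms inverse_coeffs.simps)

text \<open>
  The rate \<open>M\<close> must dominate \<open>norm G * s\<close> for the recursion to close, and be at least \<open>1\<close> so that
  the power \<open>n - 1\<close>, from the term \<open>i = 1\<close>, majorizes the powers in the other terms.
\<close>

lemma norm_inverse_coeffs_le:
  assumes B: "\<And>n. (\<Sum>i=1..n. norm (B i)) \<le> s" and M: "M \<ge> 1" "norm G * s \<le> M"
  shows "norm (inverse_coeffs G B n) \<le> norm G * M ^ n"
proof (induction n rule: less_induct)
  case (less n)
  show ?case
  proof (cases "n = 0")
    case False
    let ?R = "\<Sum>i=1..n. B i o\<^sub>L inverse_coeffs G B (n - i)"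
    have "norm ?R \<le> (\<Sum>i=1..n. norm (B i) * (norm G * M ^ (n - 1)))"
    proof (rule sum_norm_le)
      fix i assume i: "i \<in> {1..n}"
      have "norm (B i o\<^sub>L inverse_coeffs G B (n - i)) \<le> norm (B i) * norm (inverse_coeffs G B (n - i))"
        by (rule norm_blinfun_compose)
      also have "\<dots> \<le> norm (B i) * (norm G * M ^ (n - i))"
        using i by (intro mult_left_mono less.IH) auto
      also have "\<dots> \<le> norm (B i) * (norm G * M ^ (n - 1))"
        using i M by (intro mult_left_mono power_increasing) auto
      finally show "norm (B i o\<^sub>L inverse_coeffs G B (n - i)) \<le> norm (B i) * (norm G * M ^ (n - 1))" .
    qed
    also have "\<dots> = (\<Sum>i=1..n. norm (B i)) * (norm G * M ^ (n - 1))" by (simp add: sum_distrib_right)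
    also have "\<dots> \<le> s * (norm G * M ^ (n - 1))" using B M by (intro mult_right_mono) auto
    finally have R: "norm ?R \<le> (norm G * s) * M ^ (n - 1)" by (simp add: mult_ac)
    also have "\<dots> \<le> M * M ^ (n - 1)" using M by (intro mult_right_mono) auto
    also have "\<dots> = M ^ n" using False by (simp flip: power_Suc)
    finally have "norm ?R \<le> M ^ n" .
    then have "norm G * norm ?R \<le> norm G * M ^ n" by (intro mult_left_mono) auto
    moreover have "norm (inverse_coeffs G B n) = norm (G o\<^sub>L ?R)"
      using False by (subst inverse_coeffs.simps) simp
    ultimately show ?thesis using norm_blinfun_compose[of G ?R] by linarith
  qed (simp add: inverse_coeffs.simps)
qed

text \<open>
  The series with coefficients \<^const>\<open>inverse_coeffs\<close> converges because they grow at most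
  geometrically, and it is a right inverse by comparison of coefficients. It is a left inverse as
  well since the polynomial stays injective near \<open>0\<close>: its constant term dominates the rest.
\<close>

lemma polynomial_inverse_power_series:
  fixes B :: "nat \<Rightarrow> 'a::chilbert_space \<Rightarrow>\<^sub>L 'a"
  assumes B: "\<And>i. B i \<in> cops" "\<And>i. i > m \<Longrightarrow> B i = 0" and G: "is_op_inverse (B 0) G"
  obtains r where "r > 0"
    "\<And>w. norm w < r \<Longrightarrow> \<exists>S. (\<lambda>n. scaleC_op (w ^ n) (inverse_coeffs G B n)) sums S
        \<and> is_op_inverse (\<Sum>i\<le>m. scaleC_op (w ^ i) (B i)) S"
proof -
  define s where "s = (\<Sum>i=1..m. norm (B i))"
  define M where "M = max 1 (norm G * s)"
  have M: "M \<ge> 1" "norm G * s \<le> M" by (auto simp: M_def)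
  have B_le: "(\<Sum>i=1..n. norm (B i)) \<le> s" for n
  proof -
    have "(\<Sum>i=1..n. norm (B i)) = (\<Sum>i\<in>{1..n} \<inter> {1..m}. norm (B i))"
      by (rule sum.mono_neutral_right) (auto simp: B(2))
    also have "\<dots> \<le> s" unfolding s_def by (rule sum_mono2) auto
    finally show ?thesis .
  qed
  have G': "B 0 o\<^sub>L G = id_blinfun" "G o\<^sub>L B 0 = id_blinfun"
    using G by (auto simp: is_op_inverse_def)
  show thesis
  proof (rule that[of "1 / M"])
    show "1 / M > 0" using M by simp
    fix w :: complex assume "norm w < 1 / M"
    then have wM: "norm w * M < 1" using M by (simp add: field_simps)
    have w1: "norm w \<le> 1" using wM M mult_left_mono[of 1 M "norm w"] by simp
    let ?P = "\<Sum>i\<le>m. scaleC_op (w ^ i) (B i)"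
    have "summable (\<lambda>n. scaleC_op (w ^ n) (inverse_coeffs G B n))"
    proof (rule summable_comparison_test')
      show "summable (\<lambda>n. norm G * (norm w * M) ^ n)"
        using wM M by (intro summable_mult summable_geometric) auto
      show "norm (scaleC_op (w ^ n) (inverse_coeffs G B n)) \<le> norm G * (norm w * M) ^ n" for n
        using mult_left_mono[OF norm_inverse_coeffs_le[OF B_le M], of "norm w ^ n" n]
        by (simp add: norm_scaleC_op norm_power power_mult_distrib mult_ac)
    qed
    then obtain S where S: "(\<lambda>n. scaleC_op (w ^ n) (inverse_coeffs G B n)) sums S"
      by (auto simp: summable_def)
    have "(\<lambda>n. scaleC_op (w ^ n) (if n = 0 then id_blinfun else 0)) sums (?P o\<^sub>L S)"
      using polynomial_times_power_series[where A = B and m = m, OF B S] by (simp only: inverse_coeffs_convolution[where B = B, OF G'(1)])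
    moreover have "(\<lambda>n. scaleC_op (w ^ n) (if n = 0 then id_blinfun else 0)) =
        (\<lambda>n. if n = 0 then id_blinfun :: 'a \<Rightarrow>\<^sub>L 'a else 0)"
      by (auto simp: scaleC_op.zero_right)
    ultimately have "(\<lambda>n. if n = 0 then id_blinfun else 0) sums (?P o\<^sub>L S)" by (simp only:)
    then have PS: "?P o\<^sub>L S = id_blinfun"
      by (rule sums_unique2[OF _ sums_single[of 0 "\<lambda>_. id_blinfun"]])
    have inj: "x = 0" if "?P x = 0" for x
    proof (rule ccontr)
      assume "x \<noteq> 0"
      define R where "R = (\<Sum>i=1..m. scaleC_op (w ^ i) (B i))"
      have "{..m} = insert 0 {1..m}" by auto
      then have "?P = B 0 + R" by (simp add: R_def)
      then have B0x: "B 0 x = - R x" using that by (simp add: blinfun.add_left eq_neg_iff_add_eq_0)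
      have "norm x = norm ((G o\<^sub>L B 0) x)" by (simp only: G'(2) blinfun_apply_id_blinfun)
      also have "\<dots> = norm (G (R x))" by (simp add: B0x blinfun.minus_right)
      also have "\<dots> \<le> norm G * (norm R * norm x)"
        by (rule order_trans[OF norm_blinfun mult_left_mono[OF norm_blinfun]]) simp
      also have "\<dots> \<le> norm G * ((norm w * s) * norm x)"
      proof (intro mult_left_mono mult_right_mono)
        have "norm R \<le> (\<Sum>i=1..m. norm w * norm (B i))"
          unfolding R_def
        proof (rule sum_norm_le)
          fix i assume "i \<in> {1..m}"
          then have "norm w ^ i \<le> norm w" using w1 power_decreasing[of 1 i "norm w"] by simp
          then show "norm (scaleC_op (w ^ i) (B i)) \<le> norm w * norm (B i)"
            by (simp add: norm_scaleC_op norm_power mult_right_mono)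
        qed
        then show "norm R \<le> norm w * s" by (simp add: s_def sum_distrib_left)
      qed auto
      also have "\<dots> = norm w * (norm G * s) * norm x" by simp
      also have "\<dots> \<le> norm w * M * norm x" using M by (intro mult_right_mono mult_left_mono) auto
      also have "\<dots> < 1 * norm x" using wM \<open>x \<noteq> 0\<close> by (intro mult_strict_right_mono) auto
      finally show False by simp
    qed
    have "S o\<^sub>L ?P = id_blinfun"
    proof (rule blinfun_eqI)
      fix x
      have "?P (S (?P x)) = ?P x"
        using arg_cong[OF PS, of "\<lambda>A. blinfun_apply A (?P x)"]
        by (simp only: blinfun_apply_blinfun_compose blinfun_apply_id_blinfun)
      then have "?P (S (?P x) - x) = 0" by (simp only: blinfun.diff_right diff_self)
      then have "S (?P x) - x = 0" by (rule inj)
      then show "(S o\<^sub>L ?P) x = id_blinfun x"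
        by (simp only: blinfun_apply_blinfun_compose blinfun_apply_id_blinfun right_minus_eq)
    qed
    moreover have "?P \<in> cops" by (intro cops_sum cops_scaleC_op B)
    ultimately have "is_op_inverse ?P S" using PS is_op_inverseI by blast
    then show "\<exists>S. (\<lambda>n. scaleC_op (w ^ n) (inverse_coeffs G B n)) sums S \<and> is_op_inverse ?P S"
      using S by blast
  qed
qed

section \<open>Compact perturbations of the identity\<close>

text \<open>
  Compactness in terms of sequences, the form in which it is used; the closure under algebraic
  operations is then a matter of passing to subsequences.
\<close>

definition seq_compact_op :: "('a::chilbert_space \<Rightarrow>\<^sub>L 'a) \<Rightarrow> bool"
  where "seq_compact_op K \<longleftrightarrow>
    (\<forall>x :: nat \<Rightarrow> 'a. bounded (range x) \<longrightarrow> (\<exists>r l. strict_mono r \<and> (\<lambda>n. K (x (r n))) \<longlonglongrightarrow> l))"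

lemma seq_compact_opE:
  assumes "seq_compact_op K" "bounded (range x)"
  obtains r l where "strict_mono (r :: nat \<Rightarrow> nat)" "(\<lambda>n. K (x (r n))) \<longlonglongrightarrow> l"
  using assms unfolding seq_compact_op_def by blast

lemma compact_op_imp_seq_compact_op:
  assumes "compact_op K"
  shows "seq_compact_op K"
  unfolding seq_compact_op_def
proof (intro allI impI)
  fix x :: "nat \<Rightarrow> 'a" assume "bounded (range x)"
  then have "seq_compact (closure (blinfun_apply K ` range x))"
    using assms compact_imp_seq_compact unfolding compact_op_def by blast
  moreover have "\<forall>n. K (x n) \<in> closure (blinfun_apply K ` range x)"
    using closure_subset by fastforce
  ultimately obtain l r where "strict_mono r" "((\<lambda>n. K (x n)) \<circ> r) \<longlonglongrightarrow> l"
    by (metis seq_compactE)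
  then show "\<exists>r l. strict_mono r \<and> (\<lambda>n. K (x (r n))) \<longlonglongrightarrow> l" by (auto simp: o_def)
qed

lemma seq_compact_op_zero: "seq_compact_op 0"
  unfolding seq_compact_op_def by (auto intro!: exI[of _ id] exI[of _ 0] strict_mono_id)

lemma seq_compact_op_add:
  assumes K: "seq_compact_op K" and L: "seq_compact_op L"
  shows "seq_compact_op (K + L)"
  unfolding seq_compact_op_def
proof (intro allI impI)
  fix x :: "nat \<Rightarrow> 'a" assume x: "bounded (range x)"
  obtain r k where r: "strict_mono r" "(\<lambda>n. K (x (r n))) \<longlonglongrightarrow> k"
    using seq_compact_opE[OF K x] by blast
  have "bounded (range (\<lambda>n. x (r n)))" using x by (rule bounded_subset) auto
  then obtain t l where t: "strict_mono t" "(\<lambda>n. L (x (r (t n)))) \<longlonglongrightarrow> l"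
    using seq_compact_opE[OF L] by blast
  have "(\<lambda>n. K (x (r (t n)))) \<longlonglongrightarrow> k"
    using LIMSEQ_subseq_LIMSEQ[OF r(2) t(1)] by (simp add: o_def)
  then have "(\<lambda>n. (K + L) (x ((r \<circ> t) n))) \<longlonglongrightarrow> k + l"
    using t(2) by (simp add: blinfun.add_left tendsto_add)
  then show "\<exists>r l. strict_mono r \<and> (\<lambda>n. (K + L) (x (r n))) \<longlonglongrightarrow> l"
    using strict_mono_o[OF r(1) t(1)] by blast
qed

lemma seq_compact_op_scaleC_op:
  assumes "seq_compact_op K"
  shows "seq_compact_op (scaleC_op c K)"
  unfolding seq_compact_op_def
proof (intro allI impI)
  fix x :: "nat \<Rightarrow> 'a" assume x: "bounded (range x)"
  obtain r k where r: "strict_mono r" "(\<lambda>n. K (x (r n))) \<longlonglongrightarrow> k"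
    using seq_compact_opE[OF assms x] by blast
  have "(\<lambda>n. scaleC_op c K (x (r n))) \<longlonglongrightarrow> scaleC c k"
    by (simp add: scaleC_op.rep_eq bounded_linear.tendsto[OF bounded_linear_scaleC r(2)])
  then show "\<exists>r l. strict_mono r \<and> (\<lambda>n. scaleC_op c K (x (r n))) \<longlonglongrightarrow> l"
    using r(1) by blast
qed

lemma seq_compact_op_uminus: "seq_compact_op K \<Longrightarrow> seq_compact_op (- K)"
  using seq_compact_op_scaleC_op[of K "- 1"] by (simp add: scaleC_op.minus_left)

lemma seq_compact_op_diff: "seq_compact_op K \<Longrightarrow> seq_compact_op L \<Longrightarrow> seq_compact_op (K - L)"
  using seq_compact_op_add[OF _ seq_compact_op_uminus, of K L] by simp

lemma seq_compact_op_sum: "(\<And>i. i \<in> I \<Longrightarrow> seq_compact_op (K i)) \<Longrightarrow> seq_compact_op (sum K I)"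
  by (induction I rule: infinite_finite_induct) (auto intro: seq_compact_op_add seq_compact_op_zero)

lemma seq_compact_op_compose:
  assumes "seq_compact_op K"
  shows "seq_compact_op (K o\<^sub>L L)"
  unfolding seq_compact_op_def
proof (intro allI impI)
  fix x :: "nat \<Rightarrow> 'a" assume "bounded (range x)"
  then have "bounded (blinfun_apply L ` range x)"
    by (rule bounded_linear_image[OF _ blinfun.bounded_linear_right])
  then have "bounded (range (\<lambda>n. L (x n)))" by (simp add: image_image)
  then obtain r l where "strict_mono r" "(\<lambda>n. K (L (x (r n)))) \<longlonglongrightarrow> l"
    using seq_compact_opE[OF assms] by blast
  then show "\<exists>r l. strict_mono r \<and> (\<lambda>n. (K o\<^sub>L L) (x (r n))) \<longlonglongrightarrow> l"
    by (intro exI[of _ r] exI[of _ l]) simp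
qed

lemma csubspace_op_ker: "A \<in> cops \<Longrightarrow> csubspace (op_ker A)"
  by (simp add: csubspace_def op_ker_def blinfun.add_right copsD)

lemma closed_op_ker: "closed (op_ker A)"
proof -
  have "op_ker A = blinfun_apply A -` {0}" by (auto simp: op_ker_def)
  then show ?thesis
    using closed_vimage[OF closed_singleton linear_continuous_on[OF blinfun.bounded_linear_right]] by metis
qed

lemma csubspace_op_ran: "A \<in> cops \<Longrightarrow> csubspace (op_ran A)"
  unfolding csubspace_def op_ran_def
  by (auto simp flip: blinfun.add_right copsD intro: range_eqI[of 0 _ 0])

text \<open>
  Otherwise there are unit vectors orthogonal to the kernel whose images tend to \<open>0\<close>. By
  compactness a subsequence converges, and the limit lies in the kernel; but a unit vector
  orthogonal to the kernel has distance at least \<open>1\<close> from it.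
\<close>

lemma bounded_below_on_orth_compl_ker:
  fixes T :: "'a::chilbert_space \<Rightarrow>\<^sub>L 'a"
  assumes K: "seq_compact_op (id_blinfun - T)"
  obtains c where "c > 0" "\<And>x. x \<in> orth_compl (op_ker T) \<Longrightarrow> c * norm x \<le> norm (T x)"
proof -
  let ?V = "orth_compl (op_ker T)"
  have "\<exists>c>0. \<forall>x\<in>?V. c * norm x \<le> norm (T x)"
  proof (rule ccontr)
    assume "\<not> ?thesis"
    then have neg: "\<exists>x\<in>?V. norm (T x) < c * norm x" if "c > 0" for c
      using that by (auto simp: not_le)
    have "\<exists>u\<in>?V. norm u = 1 \<and> norm (T u) \<le> 1 / real (Suc n)" for n
    proof -
      obtain x where x: "x \<in> ?V" "norm (T x) < 1 / real (Suc n) * norm x"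
        using neg[of "1 / real (Suc n)"] by auto
      have "x \<noteq> 0" using x(2) by auto
      then show ?thesis using x
        by (intro bexI[of _ "x /\<^sub>R norm x"] csubspaceD(5)[OF csubspace_orth_compl])
          (auto simp: blinfun.scaleR_right field_simps)
    qed
    then obtain u where u: "\<And>n. u n \<in> ?V" "\<And>n. norm (u n) = 1" "\<And>n. norm (T (u n)) \<le> 1 / real (Suc n)"
      by metis
    have "bounded (range u)" using u(2) by (auto simp: bounded_iff)
    then obtain r l where r: "strict_mono r" "(\<lambda>n. (id_blinfun - T) (u (r n))) \<longlonglongrightarrow> l"
      using seq_compact_opE[OF K] by blast
    have "(\<lambda>n. T (u n)) \<longlonglongrightarrow> 0"
      by (rule Lim_null_comparison[OF _ LIMSEQ_Suc[OF lim_1_over_n]]) (simp add: u(3) del: of_nat_Suc)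
    then have T0: "(\<lambda>n. T (u (r n))) \<longlonglongrightarrow> 0"
      using LIMSEQ_subseq_LIMSEQ[OF _ r(1)] by (force simp: o_def)
    have lim: "(\<lambda>n. u (r n)) \<longlonglongrightarrow> l"
      using tendsto_add[OF r(2) T0] by (simp add: blinfun.diff_left)
    have "(\<lambda>n. T (u (r n))) \<longlonglongrightarrow> T l" by (intro blinfun.tendsto tendsto_const lim)
    then have "l \<in> op_ker T" using T0 LIMSEQ_unique by (auto simp: op_ker_def)
    then have "norm (u (r n)) \<le> norm (u (r n) - l)" for n
      using u(1) by (intro norm_le_norm_diff_orthogonal) (auto simp: orth_compl_def)
    then have "1 \<le> norm (u (r n) - l)" for n by (simp add: u(2))
    moreover have "(\<lambda>n. norm (u (r n) - l)) \<longlonglongrightarrow> 0" using lim by (simp add: LIM_zero tendsto_norm_zero)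
    ultimately show False by (meson LIMSEQ_le_const not_one_le_zero)
  qed
  then show thesis using that by blast
qed

text \<open>
  Preimages can be chosen orthogonal to the kernel, where \<open>T\<close> is bounded below; so a convergent
  sequence in the range has a Cauchy sequence of preimages.
\<close>

lemma closed_range_compact_perturbation:
  fixes T :: "'a::chilbert_space \<Rightarrow>\<^sub>L 'a"
  assumes T: "T \<in> cops" and K: "seq_compact_op (id_blinfun - T)"
  shows "closed (op_ran T)"
  unfolding closed_sequential_limits
proof (intro allI impI, elim conjE)
  fix y l assume y: "\<forall>n. y n \<in> op_ran T" and l: "y \<longlonglongrightarrow> l"
  obtain c where c: "c > 0" "\<And>x. x \<in> orth_compl (op_ker T) \<Longrightarrow> c * norm x \<le> norm (T x)"
    using bounded_below_on_orth_compl_ker[OF K] by blast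
  have "\<exists>x\<in>orth_compl (op_ker T). T x = y n" for n
  proof -
    obtain x where x: "T x = y n" using y by (metis op_ran_def rangeE)
    obtain v where v: "v \<in> op_ker T" "x - v \<in> orth_compl (op_ker T)"
      using orthogonal_decomposition[OF csubspace_op_ker[OF T] closed_op_ker] by blast
    then show ?thesis using x by (intro bexI[of _ "x - v"]) (auto simp: blinfun.diff_right op_ker_def)
  qed
  then obtain x where x: "\<And>n. x n \<in> orth_compl (op_ker T)" "\<And>n. T (x n) = y n" by metis
  have close: "norm (x m - x n) \<le> norm (y m - y n) / c" for m n
    using c(2)[OF csubspaceD(4)[OF csubspace_orth_compl x(1) x(1)], of m n] c(1)
    by (simp add: blinfun.diff_right x(2) field_simps)
  have "Cauchy x"
  proof (rule metric_CauchyI)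
    fix e :: real assume "e > 0"
    then have "e * c > 0" using c(1) by simp
    then obtain M where M: "\<And>m n. m \<ge> M \<Longrightarrow> n \<ge> M \<Longrightarrow> dist (y m) (y n) < e * c"
      using metric_CauchyD[OF LIMSEQ_imp_Cauchy[OF l]] by blast
    have "dist (x m) (x n) < e" if "m \<ge> M" "n \<ge> M" for m n
      using le_less_trans[OF close divide_strict_right_mono[OF M[OF that, unfolded dist_norm] c(1)]] c(1)
      by (simp add: dist_norm)
    then show "\<exists>M. \<forall>m\<ge>M. \<forall>n\<ge>M. dist (x m) (x n) < e" by blast
  qed
  then obtain z where "x \<longlonglongrightarrow> z" using Cauchy_convergent convergent_def by blast
  then have "(\<lambda>n. T (x n)) \<longlonglongrightarrow> T z" by (intro blinfun.tendsto tendsto_const)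
  then have "T z = l" using l LIMSEQ_unique by (auto simp: x(2))
  then show "l \<in> op_ran T" by (auto simp: op_ran_def)
qed

text \<open>
  Riesz's argument. If \<open>T\<close> is surjective with a nontrivial kernel, then the kernels of the powers of
  \<open>T\<close> increase strictly. Unit vectors \<open>e n\<close> in the \<open>(n + 1)\<close>-st kernel orthogonal to the \<open>n\<close>-th one
  have images under \<open>I - T\<close> that keep distance at least \<open>1\<close> from each other, because \<open>T\<close> lowers
  each kernel by one step.
\<close>

lemma surj_compact_perturbation_imp_inj:
  fixes T :: "'a::chilbert_space \<Rightarrow>\<^sub>L 'a"
  assumes T: "T \<in> cops" and K: "seq_compact_op (id_blinfun - T)"
    and surj: "surj (blinfun_apply T)"
  shows "op_ker T = {0}"
proof (rule ccontr)
  assume "op_ker T \<noteq> {0}"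
  then obtain x0 where x0: "T x0 = 0" "x0 \<noteq> 0"
    using csubspaceD(1)[OF csubspace_op_ker[OF T]] by (auto simp: op_ker_def)
  (* N n is the kernel of the n-th power of T. *)
  define N where "N n = op_ker (((o\<^sub>L) T ^^ n) id_blinfun)" for n
  have pow: "(((o\<^sub>L) T ^^ n) id_blinfun) x = (blinfun_apply T ^^ n) x" for n x
    by (induction n) auto
  have "((o\<^sub>L) T ^^ n) id_blinfun \<in> cops" for n
    by (induction n) (auto intro: cops_compose T)
  then have N: "csubspace (N n)" "closed (N n)" for n
    by (auto simp: N_def csubspace_op_ker closed_op_ker)
  have N_iff: "x \<in> N n \<longleftrightarrow> (blinfun_apply T ^^ n) x = 0" for x n
    by (simp add: N_def op_ker_def pow)
  have N_Suc: "x \<in> N (Suc n) \<longleftrightarrow> T x \<in> N n" for x n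
    by (simp only: N_iff funpow_Suc_right o_apply)
  have N_step: "N n \<subseteq> N (Suc n)" for n
    by (auto simp: N_iff blinfun.zero_right)
  then have N_mono: "N m \<subseteq> N n" if "m \<le> n" for m n
    using that by (rule lift_Suc_mono_le)
  have "\<exists>x. x \<in> N (Suc n) \<and> x \<notin> N n" for n
  proof (induction n)
    case 0
    show ?case using x0 by (intro exI[of _ x0]) (auto simp: N_iff x0 N_Suc)
  next
    case (Suc n)
    then obtain x where x: "x \<in> N (Suc n)" "x \<notin> N n" by blast
    obtain y where "T y = x" using surj by (metis surjD)
    then have "y \<in> N (Suc (Suc n))" "y \<notin> N (Suc n)" using x by (auto simp: N_Suc)
    then show ?case by blast
  qed
  then have "\<exists>e. e \<in> N (Suc n) \<and> e \<in> orth_compl (N n) \<and> norm e = 1" for n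
  proof -
    assume "\<And>n. \<exists>x. x \<in> N (Suc n) \<and> x \<notin> N n"
    then obtain x where x: "x \<in> N (Suc n)" "x \<notin> N n" by blast
    obtain v where v: "v \<in> N n" "x - v \<in> orth_compl (N n)"
      using orthogonal_decomposition[OF N] by blast
    have "x - v \<in> N (Suc n)" using x v N_step by (blast intro: csubspaceD(4)[OF N(1)])
    moreover have "x - v \<noteq> 0" using x v by auto
    ultimately show ?thesis using v
      by (intro exI[of _ "(x - v) /\<^sub>R norm (x - v)"])
        (auto intro!: csubspaceD(5)[OF csubspace_orth_compl] csubspaceD(5)[OF N(1)])
  qed
  then obtain e where e: "\<And>n. e n \<in> N (Suc n)" "\<And>n. e n \<in> orth_compl (N n)" "\<And>n. norm (e n) = 1"
    by metis
  let ?K = "id_blinfun - T"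
  have far: "1 \<le> norm (?K (e n) - ?K (e m))" if "m < n" for m n
  proof -
    define z where "z = T (e n) + (e m - T (e m))"
    have "T (e n) \<in> N n" using e(1) N_Suc by blast
    moreover have "e m \<in> N n" using e(1)[of m] N_mono[of "Suc m" n] that by auto
    moreover have "T (e m) \<in> N n" using e(1)[of m] N_Suc N_mono[of m n] that by auto
    ultimately have "z \<in> N n" unfolding z_def by (intro csubspaceD(2,4)[OF N(1)])
    then have "norm (e n) \<le> norm (e n - z)"
      using e(2)[of n] by (intro norm_le_norm_diff_orthogonal) (simp add: orth_compl_def)
    moreover have "?K (e n) - ?K (e m) = e n - z" by (simp add: z_def blinfun.diff_left)
    ultimately show ?thesis by (simp add: e(3))
  qed
  have "bounded (range e)" using e(3) by (auto simp: bounded_iff)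
  then obtain r l where r: "strict_mono r" "(\<lambda>n. ?K (e (r n))) \<longlonglongrightarrow> l"
    using seq_compact_opE[OF K] by blast
  obtain M where "\<And>m n. m \<ge> M \<Longrightarrow> n \<ge> M \<Longrightarrow> dist (?K (e (r m))) (?K (e (r n))) < 1"
    using metric_CauchyD[OF LIMSEQ_imp_Cauchy[OF r(2)], of 1] by auto
  from this[of "Suc M" M] have "norm (?K (e (r (Suc M))) - ?K (e (r M))) < 1" by (simp add: dist_norm)
  moreover have "r M < r (Suc M)" using r(1) by (simp add: strict_mono_def)
  ultimately show False using far by fastforce
qed

lemma surj_compact_perturbation_imp_inverse:
  fixes T :: "'a::chilbert_space \<Rightarrow>\<^sub>L 'a"
  assumes T: "T \<in> cops" and K: "seq_compact_op (id_blinfun - T)"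
    and surj: "surj (blinfun_apply T)"
  obtains G where "is_op_inverse T G"
proof -
  have ker: "op_ker T = {0}" by (rule surj_compact_perturbation_imp_inj[OF assms])
  obtain c where c: "c > 0" "\<And>x. c * norm x \<le> norm (T x)"
    using bounded_below_on_orth_compl_ker[OF K] by (auto simp: ker orth_compl_def)
  have inj: "inj (blinfun_apply T)"
  proof (rule injI)
    fix x y assume "T x = T y"
    then have "x - y \<in> op_ker T" by (simp add: op_ker_def blinfun.diff_right)
    then show "x = y" by (simp add: ker)
  qed
  let ?g = "inv (blinfun_apply T)"
  have Tg: "T (?g y) = y" for y using surj by (rule surj_f_inv_f)
  have gT: "?g (T x) = x" for x using inj by (rule inv_f_f)
  have "bounded_linear ?g"
  proof (rule bounded_linear_intro[of _ "1 / c"])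
    show "?g (x + y) = ?g x + ?g y" for x y
      by (metis gT Tg blinfun.add_right)
    show "?g (r *\<^sub>R x) = r *\<^sub>R ?g x" for r x
      by (metis gT Tg blinfun.scaleR_right)
    show "norm (?g x) \<le> norm x * (1 / c)" for x
      using c(2)[of "?g x"] c(1) by (simp add: Tg field_simps)
  qed
  then have app: "blinfun_apply (Blinfun ?g) = ?g" by (rule bounded_linear_Blinfun_apply)
  have "is_op_inverse T (Blinfun ?g)"
    by (rule is_op_inverseI[OF T]; rule blinfun_eqI) (simp_all add: app Tg gT)
  then show thesis by (rule that)
qed

section \<open>Orthogonal projections as operators\<close>

definition proj_op :: "'a::chilbert_space set \<Rightarrow> ('a \<Rightarrow>\<^sub>L 'a)"
  where "proj_op V = Blinfun (orth_proj V)"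

lemma proj_op_apply: "csubspace V \<Longrightarrow> closed V \<Longrightarrow> blinfun_apply (proj_op V) = orth_proj V"
  unfolding proj_op_def by (intro bounded_linear_Blinfun_apply bounded_linear_orth_proj)

lemma proj_op_in_cops: "csubspace V \<Longrightarrow> closed V \<Longrightarrow> proj_op V \<in> cops"
  by (simp add: cops_def proj_op_apply bounded_linear_orth_proj)

lemma orth_proj_ident: "csubspace V \<Longrightarrow> x \<in> V \<Longrightarrow> orth_proj V x = x"
  by (rule orth_proj_eqI) (simp_all add: csubspaceD(1)[OF csubspace_orth_compl])

lemma orth_proj_orth_compl_in:
  assumes "csubspace V" "closed V"
  shows "orth_proj (orth_compl V) x \<in> orth_compl V"
  using orth_proj_in(2)[OF assms] by (simp add: orth_proj_orth_compl[OF assms])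

lemma orth_proj_orth_compl_eq_iff:
  assumes V: "csubspace V" "closed V"
  shows "orth_proj (orth_compl V) x = orth_proj (orth_compl V) y \<longleftrightarrow> x - y \<in> V"
proof
  assume "orth_proj (orth_compl V) x = orth_proj (orth_compl V) y"
  then have "x - y = orth_proj V x - orth_proj V y"
    by (simp add: orth_proj_orth_compl[OF V] algebra_simps)
  then show "x - y \<in> V" using csubspaceD(4)[OF V(1)] orth_proj_in(1)[OF V] by simp
next
  assume "x - y \<in> V"
  then have "(x - y) + orth_proj V y \<in> V"
    by (intro csubspaceD(2)[OF V(1)] orth_proj_in(1)[OF V])
  then have "x - orth_proj (orth_compl V) y \<in> orth_compl (orth_compl V)"
    using subset_orth_compl_orth_compl[of V] by (auto simp: orth_proj_orth_compl[OF V] algebra_simps)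
  then show "orth_proj (orth_compl V) x = orth_proj (orth_compl V) y"
    by (intro orth_proj_eqI csubspace_orth_compl orth_proj_orth_compl_in V)
qed

section \<open>Simple poles of inverse operator polynomials\<close>

text \<open>
  Comparing coefficients in \<open>T(z) (z - a) T(z)\<^sup>-\<^sup>1 = (z - a) I\<close>.
\<close>

lemma simple_pole_imp_coefficient_equations:
  fixes T :: "complex \<Rightarrow> 'a::chilbert_space \<Rightarrow>\<^sub>L 'a"
  assumes A: "\<And>i. A i \<in> cops" "\<And>i. i > m \<Longrightarrow> A i = 0"
    and T: "\<And>w. T (a + w) = (\<Sum>i\<le>m. scaleC_op (w ^ i) (A i))"
    and U: "inverse_laurent T a 1 U"
  shows "A 0 o\<^sub>L U (- 1) = 0" and "(A 0 o\<^sub>L U 0) + (A 1 o\<^sub>L U (- 1)) = id_blinfun"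
proof -
  define E where "E n = U (int n - 1)" for n
  obtain r where r: "r > 0" "\<And>z. z \<noteq> a \<Longrightarrow> dist z a < r \<Longrightarrow> op_invertible (T z) \<and>
      (\<lambda>n. scaleC_op ((z - a) powi (int n - 1)) (U (int n - 1))) sums op_inverse (T z)"
    using U by (auto simp: inverse_laurent_def)
  have "(\<lambda>n. scaleC_op (w ^ n) (\<Sum>i\<le>n. A i o\<^sub>L E (n - i))) sums scaleC_op w id_blinfun"
    if w: "w \<noteq> 0" "norm w < r" for w
  proof -
    let ?R = "op_inverse (T (a + w))"
    have inv: "op_invertible (T (a + w))"
      and s: "(\<lambda>n. scaleC_op (w powi (int n - 1)) (U (int n - 1))) sums ?R"
      using r(2)[of "a + w"] w by (auto simp: dist_norm)
    have "w * w powi (int n - 1) = w ^ n" for n using w by (simp add: power_int_diff)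
    then have "(\<lambda>n. scaleC_op (w ^ n) (E n)) sums scaleC_op w ?R"
      using bounded_linear.sums[OF scaleC_op.bounded_linear_right s, of w] by (simp add: E_def)
    from polynomial_times_power_series[where A = A and m = m, OF A this]
    have "(\<lambda>n. scaleC_op (w ^ n) (\<Sum>i\<le>n. A i o\<^sub>L E (n - i))) sums (T (a + w) o\<^sub>L scaleC_op w ?R)"
      unfolding T .
    moreover have "T (a + w) \<in> cops" unfolding T by (intro cops_sum cops_scaleC_op A)
    then have "T (a + w) o\<^sub>L scaleC_op w ?R = scaleC_op w (T (a + w) o\<^sub>L ?R)"
      by (rule scaleC_op_compose_right)
    ultimately show ?thesis
      using is_op_inverse_op_inverse[OF inv] by (simp add: is_op_inverse_def)
  qed
  note c = power_series_eq_linear_imp_coefficients[OF r(1) this]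
  show "A 0 o\<^sub>L U (- 1) = 0" using c(1) by (simp add: E_def)
  show "(A 0 o\<^sub>L U 0) + (A 1 o\<^sub>L U (- 1)) = id_blinfun" using c(2) by (simp add: E_def)
qed

lemma is_op_inverse_compose:
  assumes "is_op_inverse A B" "is_op_inverse C D"
  shows "is_op_inverse (A o\<^sub>L C) (D o\<^sub>L B)"
proof -
  have i: "A (B x) = x" "B (A x) = x" "C (D x) = x" "D (C x) = x" for x
    using assms unfolding is_op_inverse_def
    by (metis blinfun_apply_blinfun_compose blinfun_apply_id_blinfun)+
  show ?thesis
    using assms unfolding is_op_inverse_def
    by (intro conjI cops_compose blinfun_eqI) (simp_all add: i)
qed

lemma invertible_scaled_projection:
  assumes P: "P \<in> cops" "P o\<^sub>L P = P" and w: "w \<noteq> 0"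
  shows "is_op_inverse ((id_blinfun - P) + scaleC_op w P) ((id_blinfun - P) + scaleC_op (1 / w) P)"
proof -
  have PP: "P (P x) = P x" for x using P(2) by (metis blinfun_apply_blinfun_compose)
  have s: "P (scaleC c x) = scaleC c (P x)" for c x using P(1) by (rule copsD)
  show ?thesis
    by (intro is_op_inverseI blinfun_eqI)
      (simp_all add: cops_add cops_diff cops_scaleC_op P blinfun.add_left blinfun.diff_left
        blinfun.add_right blinfun.diff_right scaleC_op.rep_eq PP s scaleC_add_right scaleC_scaleC w
        linear_diff[OF bounded_linear.linear[OF bounded_linear_scaleC]])
qed

text \<open>
  Since \<open>A 0\<close> vanishes on the range of \<open>P\<close>, a factor \<open>w\<close> can be split off there:
  \<open>T(a + w) = B(w) (I - P + w P)\<close> with a polynomial \<open>B\<close> such that \<open>B(0) = A 0 + A 1 P\<close>.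
\<close>

lemma factor_out_projection:
  fixes A :: "nat \<Rightarrow> 'a::chilbert_space \<Rightarrow>\<^sub>L 'a"
  assumes A: "\<And>i. A i \<in> cops" "\<And>i. i > m \<Longrightarrow> A i = 0"
    and P: "P \<in> cops" "P o\<^sub>L P = P" and AP: "A 0 o\<^sub>L P = 0"
    and B: "\<And>i. B i = (if i = 0 then A 0 + (A 1 o\<^sub>L P) else (A i o\<^sub>L (id_blinfun - P)) + (A (Suc i) o\<^sub>L P))"
  shows "(\<Sum>i\<le>m. scaleC_op (w ^ i) (B i)) o\<^sub>L ((id_blinfun - P) + scaleC_op w P)
    = (\<Sum>i\<le>m. scaleC_op (w ^ i) (A i))"
proof (rule blinfun_eqI)
  fix x
  have PP: "P (P x) = P x" for x using P(2) by (metis blinfun_apply_blinfun_compose)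
  have s: "P (scaleC c x) = scaleC c (P x)" "A i (scaleC c x) = scaleC c (A i x)" for c x i
    using P(1) A(1) by (auto intro: copsD)
  have A0P: "A 0 (P x) = 0" for x using AP by (metis blinfun_apply_blinfun_compose blinfun.zero_left)
  let ?y = "((id_blinfun - P) + scaleC_op w P) x"
  let ?f = "\<lambda>i. scaleC (w ^ i) (A i (P x))"
  have each: "scaleC (w ^ i) (B i ?y) = scaleC (w ^ i) (A i (x - P x)) + ?f (Suc i)" for i
    by (cases "i = 0")
      (simp_all add: B blinfun.add_left blinfun.diff_left blinfun.add_right blinfun.diff_right
        scaleC_op.rep_eq PP s A0P scaleC_add_right scaleC_scaleC mult.commute
        linear_diff[OF bounded_linear.linear[OF bounded_linear_scaleC]])
  have "(\<Sum>i\<le>m. ?f (Suc i)) = (\<Sum>i\<le>Suc m. ?f i) - ?f 0" by (simp only: sum.atMost_Suc_shift add_diff_cancel_left')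
  also have "\<dots> = (\<Sum>i\<le>m. ?f i)" by (simp add: A(2) A0P)
  finally have shift: "(\<Sum>i\<le>m. ?f (Suc i)) = (\<Sum>i\<le>m. ?f i)" .
  have "((\<Sum>i\<le>m. scaleC_op (w ^ i) (B i)) o\<^sub>L ((id_blinfun - P) + scaleC_op w P)) x
      = (\<Sum>i\<le>m. scaleC (w ^ i) (B i ?y))"
    by (simp add: blinfun.sum_left scaleC_op.rep_eq)
  also have "\<dots> = (\<Sum>i\<le>m. scaleC (w ^ i) (A i (x - P x))) + (\<Sum>i\<le>m. ?f i)"
    by (simp only: each sum.distrib shift)
  also have "\<dots> = (\<Sum>i\<le>m. scaleC (w ^ i) (A i x))"
    by (simp add: blinfun.diff_right linear_diff[OF bounded_linear.linear[OF bounded_linear_scaleC]] flip: sum.distrib)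
  also have "\<dots> = (\<Sum>i\<le>m. scaleC_op (w ^ i) (A i)) x"
    by (simp add: blinfun.sum_left scaleC_op.rep_eq)
  finally show "((\<Sum>i\<le>m. scaleC_op (w ^ i) (B i)) o\<^sub>L ((id_blinfun - P) + scaleC_op w P)) x
    = (\<Sum>i\<le>m. scaleC_op (w ^ i) (A i)) x" .
qed

text \<open>
  By the factorization, \<open>T(a + w)\<^sup>-\<^sup>1 = (I - P + w\<^sup>-\<^sup>1 P) B(w)\<^sup>-\<^sup>1\<close>, and \<open>B(w)\<^sup>-\<^sup>1\<close> is a power series
  near \<open>0\<close> with constant term \<open>G\<close>. The coefficient \<open>P G\<close> of \<open>w\<^sup>-\<^sup>1\<close> does not vanish because
  \<open>P = (P G) B(0)\<close>.
\<close>

lemma simple_pole_if_invertible: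
  fixes T :: "complex \<Rightarrow> 'a::chilbert_space \<Rightarrow>\<^sub>L 'a"
  assumes A: "\<And>i. A i \<in> cops" "\<And>i. i > m \<Longrightarrow> A i = 0"
    and T: "\<And>w. T (a + w) = (\<Sum>i\<le>m. scaleC_op (w ^ i) (A i))"
    and P: "P \<in> cops" "P o\<^sub>L P = P" and AP: "A 0 o\<^sub>L P = 0" and P0: "P \<noteq> 0"
    and G: "is_op_inverse (A 0 + (A 1 o\<^sub>L P)) G"
  shows "inverse_has_pole T a 1"
proof -
  define B where
    "B i = (if i = 0 then A 0 + (A 1 o\<^sub>L P) else (A i o\<^sub>L (id_blinfun - P)) + (A (Suc i) o\<^sub>L P))" for i
  have B: "B i \<in> cops" for i
    by (auto simp: B_def intro!: cops_add cops_compose cops_diff A P)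
  have Bm: "B i = 0" if "i > m" for i using that A(2) by (auto simp: B_def)
  have G0: "is_op_inverse (B 0) G" using G by (simp add: B_def)
  define E where "E = inverse_coeffs G B"
  obtain r where r: "r > 0" "\<And>w. norm w < r \<Longrightarrow> \<exists>S. (\<lambda>n. scaleC_op (w ^ n) (E n)) sums S
        \<and> is_op_inverse (\<Sum>i\<le>m. scaleC_op (w ^ i) (B i)) S"
    unfolding E_def using polynomial_inverse_power_series[where B = B and m = m, OF B Bm G0] by metis
  (* As w T(a + w)^(-1) = (P + w (I - P)) B(w)^(-1), the Laurent coefficients U are the convolution
     of the coefficients D of P + w (I - P) with E, shifted by one. *)
  define D where "D i = (if i = 0 then P else if i = 1 then id_blinfun - P else 0)" for i :: nat
  have D: "D i \<in> cops" "i > 1 \<Longrightarrow> D i = 0" for i by (auto simp: D_def P intro: cops_diff)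
  define U where "U k = (\<Sum>i\<le>nat (k + 1). D i o\<^sub>L E (nat (k + 1) - i))" for k
  have "G \<in> cops" using G by (simp add: is_op_inverse_def)
  then have "E n \<in> cops" for n unfolding E_def using B by (rule inverse_coeffs_in_cops)
  then have U: "U k \<in> cops" for k unfolding U_def by (intro cops_sum cops_compose D)
  have "U (- 1) \<noteq> 0"
  proof
    assume "U (- 1) = 0"
    then have "P o\<^sub>L G = 0" by (simp add: U_def D_def E_def inverse_coeffs.simps)
    moreover have "P x = (P o\<^sub>L G) (B 0 x)" for x
      using G0 unfolding is_op_inverse_def
      by (metis blinfun_apply_blinfun_compose blinfun_apply_id_blinfun)
    ultimately have "P = 0" by (intro blinfun_eqI) simp
    with P0 show False ..
  qed
  moreover have "op_invertible (T z) \<and>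
      (\<lambda>n. scaleC_op ((z - a) powi (int n - int 1)) (U (int n - int 1))) sums op_inverse (T z)"
    if z: "z \<noteq> a" "dist z a < r" for z
  proof -
    define w where "w = z - a"
    have w: "w \<noteq> 0" "norm w < r" using z by (auto simp: w_def dist_norm)
    obtain S where S: "(\<lambda>n. scaleC_op (w ^ n) (E n)) sums S"
        "is_op_inverse (\<Sum>i\<le>m. scaleC_op (w ^ i) (B i)) S"
      using r(2)[OF w(2)] by blast
    have "T z = (\<Sum>i\<le>m. scaleC_op (w ^ i) (B i)) o\<^sub>L ((id_blinfun - P) + scaleC_op w P)"
      using T[of w] factor_out_projection[where A = A and B = B and m = m, OF A P AP B_def]
      by (simp add: w_def)
    then have inv: "is_op_inverse (T z) (((id_blinfun - P) + scaleC_op (1 / w) P) o\<^sub>L S)"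
      using is_op_inverse_compose[OF S(2) invertible_scaled_projection[OF P w(1)]] by simp
    have "(\<Sum>i\<le>1. scaleC_op (w ^ i) (D i)) = P + scaleC_op w (id_blinfun - P)"
      by (simp add: D_def)
    then have "(\<lambda>n. scaleC_op (w ^ n) (U (int n - 1))) sums ((P + scaleC_op w (id_blinfun - P)) o\<^sub>L S)"
      using polynomial_times_power_series[where A = D and m = 1, OF D S(1)] by (simp add: U_def)
    from bounded_linear.sums[OF scaleC_op.bounded_linear_right this, of "1 / w"]
    have "(\<lambda>n. scaleC_op (1 / w * w ^ n) (U (int n - 1))) sums
        (scaleC_op (1 / w) (P + scaleC_op w (id_blinfun - P)) o\<^sub>L S)"
      by (simp add: scaleC_op_compose_left)
    moreover have "1 / w * w ^ n = w powi (int n - 1)" for n using w by (simp add: power_int_diff)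
    moreover have "scaleC_op (1 / w) (P + scaleC_op w (id_blinfun - P)) = (id_blinfun - P) + scaleC_op (1 / w) P"
      using w by (simp add: scaleC_op.add_right)
    ultimately have "(\<lambda>n. scaleC_op (w powi (int n - 1)) (U (int n - 1))) sums
        (((id_blinfun - P) + scaleC_op (1 / w) P) o\<^sub>L S)" by (simp only:)
    then show ?thesis using inv op_inverse_eqI[OF inv] by (auto simp: op_invertible_def w_def)
  qed
  ultimately have "inverse_laurent T a 1 U"
    unfolding inverse_laurent_def using U r(1) by auto
  then show ?thesis unfolding inverse_has_pole_def by blast
qed

section \<open>The Taylor expansion of the pencil\<close>

definition pencil_coeff :: "nat \<Rightarrow> (nat \<Rightarrow> 'a::chilbert_space \<Rightarrow>\<^sub>L 'a) \<Rightarrow> nat \<Rightarrow> ('a \<Rightarrow>\<^sub>L 'a)"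
  where "pencil_coeff p C i =
    (if i = 0 then id_blinfun else 0) - (\<Sum>j=1..p. scaleC_op (of_nat (j choose i)) (C j))"

lemma pencil_taylor: "pencil p C (1 + w) = (\<Sum>i\<le>p. scaleC_op (w ^ i) (pencil_coeff p C i))"
proof -
  have pow: "(1 + w) ^ j = (\<Sum>i\<le>p. w ^ i * of_nat (j choose i))" if "j \<le> p" for j
  proof -
    have "(1 + w) ^ j = (\<Sum>i\<le>j. w ^ i * of_nat (j choose i))"
      using binomial_ring[of w 1 j] by (simp add: add.commute mult.commute)
    also have "\<dots> = (\<Sum>i\<le>p. w ^ i * of_nat (j choose i))"
      using that by (intro sum.mono_neutral_left) auto
    finally show ?thesis .
  qed
  have "(\<Sum>j=1..p. scaleC_op ((1 + w) ^ j) (C j))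
      = (\<Sum>j=1..p. \<Sum>i\<le>p. scaleC_op (w ^ i * of_nat (j choose i)) (C j))"
    by (intro sum.cong refl) (simp add: pow scaleC_op.sum_left)
  also have "\<dots> = (\<Sum>i\<le>p. \<Sum>j=1..p. scaleC_op (w ^ i * of_nat (j choose i)) (C j))"
    by (rule sum.swap)
  finally have s: "(\<Sum>j=1..p. scaleC_op ((1 + w) ^ j) (C j))
      = (\<Sum>i\<le>p. scaleC_op (w ^ i) (\<Sum>j=1..p. scaleC_op (of_nat (j choose i)) (C j)))"
    by (simp add: scaleC_op.sum_right)
  have "(\<Sum>i\<le>p. scaleC_op (w ^ i) (if i = 0 then id_blinfun else 0))
      = (\<Sum>i\<le>p. if i = 0 then id_blinfun else 0 :: 'a \<Rightarrow>\<^sub>L 'a)"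
    by (intro sum.cong refl) (simp add: scaleC_op.zero_right)
  also have "\<dots> = id_blinfun" by (simp add: sum.delta)
  finally show ?thesis
    by (simp only: pencil_def pencil_coeff_def scaleC_op.diff_right sum_subtractf s)
qed

lemma pencil_coeff_0: "pencil_coeff p C 0 = pencil p C 1"
  by (simp add: pencil_coeff_def pencil_def)

lemma pencil_coeff_in_cops:
  assumes "\<And>j. j \<in> {1..p} \<Longrightarrow> C j \<in> cops"
  shows "pencil_coeff p C i \<in> cops"
  unfolding pencil_coeff_def by (intro cops_diff cops_sum cops_scaleC_op assms) auto

lemma pencil_coeff_eq_0: "i > p \<Longrightarrow> pencil_coeff p C i = 0"
  by (simp add: pencil_coeff_def scaleC_op.zero_left binomial_eq_0)

lemma seq_compact_op_pencil_coeff: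
  assumes "\<And>j. j \<in> {1..p} \<Longrightarrow> seq_compact_op (C j)"
  shows "seq_compact_op (id_blinfun - pencil_coeff p C 0)"
    and "i > 0 \<Longrightarrow> seq_compact_op (pencil_coeff p C i)"
  unfolding pencil_coeff_def using assms
  by (auto intro!: seq_compact_op_uminus seq_compact_op_sum seq_compact_op_scaleC_op)

lemma op_deriv_eqI:
  assumes "(T has_derivative (\<lambda>h. scaleC_op h D)) (at z)"
  shows "op_deriv T z = D"
  unfolding op_deriv_def
proof (rule the_equality)
  fix D' assume "(T has_derivative (\<lambda>h. scaleC_op h D')) (at z)"
  then have "scaleC_op 1 D' = scaleC_op 1 D"
    using has_derivative_unique[OF assms] by metis
  then show "D' = D" by simp
qed (rule assms)

lemma op_deriv_pencil: "op_deriv (pencil p C) 1 = pencil_coeff p C 1"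
proof (rule op_deriv_eqI)
  have "((\<lambda>z. scaleC_op (z ^ j) (C j)) has_derivative (\<lambda>h. scaleC_op (of_nat j * h) (C j))) (at 1)" for j
  proof -
    have "((\<lambda>z::complex. z ^ j) has_derivative (\<lambda>h. of_nat j * h)) (at 1)"
      by (auto intro!: derivative_eq_intros)
    then show ?thesis by (rule bounded_linear.has_derivative[OF scaleC_op.bounded_linear_left])
  qed
  then have "(pencil p C has_derivative (\<lambda>h. 0 - (\<Sum>j=1..p. scaleC_op (of_nat j * h) (C j)))) (at 1)"
    unfolding pencil_def by (intro has_derivative_diff has_derivative_const has_derivative_sum)
  moreover have "0 - (\<Sum>j=1..p. scaleC_op (of_nat j * h) (C j)) = scaleC_op h (pencil_coeff p C 1)" for h
    by (simp add: pencil_coeff_def scaleC_op.minus_right scaleC_op.sum_right mult.commute)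
  ultimately show "(pencil p C has_derivative (\<lambda>h. scaleC_op h (pencil_coeff p C 1))) (at 1)"
    by simp
qed

section \<open>Range plus image of the kernel\<close>

text \<open>
  The operator \<open>A + B P\<close>, with \<open>P\<close> the projection onto \<open>ker A\<close>, maps onto \<open>ran A + B (ker A)\<close> and
  is a compact perturbation of the identity. So if that sum is all of the space, Riesz's argument
  makes the operator invertible.
\<close>

lemma ran_plus_image_ker_imp_inverse:
  fixes A B :: "'a::chilbert_space \<Rightarrow>\<^sub>L 'a"
  assumes A: "A \<in> cops" "seq_compact_op (id_blinfun - A)" and B: "B \<in> cops" "seq_compact_op B"
    and sum: "op_ran A + blinfun_apply B ` op_ker A = UNIV"
  obtains G where "is_op_inverse (A + (B o\<^sub>L proj_op (op_ker A))) G"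
proof -
  define N where "N = op_ker A"
  have N: "csubspace N" "closed N" by (simp_all add: N_def csubspace_op_ker A closed_op_ker)
  let ?T = "A + (B o\<^sub>L proj_op N)"
  note app = proj_op_apply[OF N]
  have T_app: "?T x = A x + B (orth_proj N x)" for x by (simp add: blinfun.add_left app)
  have AN: "A x = 0" if "x \<in> N" for x using that by (simp add: N_def op_ker_def)
  have "\<exists>x. ?T x = y" for y
  proof -
    have "y \<in> op_ran A + blinfun_apply B ` N" using sum by (simp add: N_def)
    then obtain u n where y: "y = A u + B n" "n \<in> N"
      by (auto simp: set_plus_def op_ran_def)
    define v where "v = orth_proj N u"
    have v: "v \<in> N" unfolding v_def by (rule orth_proj_in(1)[OF N])
    have "orth_proj N (u - v + n) = orth_proj N u - orth_proj N v + orth_proj N n"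
      using blinfun.add_right[of "proj_op N"] blinfun.diff_right[of "proj_op N"] by (simp add: app)
    then have "orth_proj N (u - v + n) = n"
      using v y(2) by (simp add: v_def orth_proj_ident[OF N(1)])
    then have "?T (u - v + n) = A (u - v + n) + B n" by (simp only: T_app)
    then have "?T (u - v + n) = y"
      using AN[OF v] AN[OF y(2)] by (simp only: y(1) blinfun.add_right blinfun.diff_right) simp
    then show ?thesis by blast
  qed
  then have "surj (blinfun_apply ?T)" by (metis surjI)
  moreover have "?T \<in> cops" by (intro cops_add cops_compose A B proj_op_in_cops N)
  moreover have "id_blinfun - ?T = (id_blinfun - A) - (B o\<^sub>L proj_op N)" by simp
  then have "seq_compact_op (id_blinfun - ?T)"
    using seq_compact_op_diff[OF A(2) seq_compact_op_compose[OF B(2)]] by (simp only:)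
  ultimately show thesis
    using surj_compact_perturbation_imp_inverse that by (metis N_def)
qed

lemma inverse_imp_ker_Int_vimage_ran_trivial:
  fixes A B :: "'a::chilbert_space \<Rightarrow>\<^sub>L 'a"
  assumes A: "A \<in> cops" and G: "is_op_inverse (A + (B o\<^sub>L proj_op (op_ker A))) G"
    and x: "x \<in> op_ker A" "B x \<in> op_ran A"
  shows "x = 0"
proof -
  define N where "N = op_ker A"
  have N: "csubspace N" "closed N" by (simp_all add: N_def csubspace_op_ker A closed_op_ker)
  let ?T = "A + (B o\<^sub>L proj_op N)"
  note app = proj_op_apply[OF N]
  have T_app: "?T x = A x + B (orth_proj N x)" for x by (simp add: blinfun.add_left app)
  obtain u where u: "B x = A u" using x(2) by (auto simp: op_ran_def)
  (* If B x = A u, then A + B P takes the same value at x and at u - P u, while P fixes x and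
     annihilates u - P u. *)
  define v where "v = orth_proj N u"
  have v: "v \<in> N" unfolding v_def by (rule orth_proj_in(1)[OF N])
  have Pv: "orth_proj N (u - v) = 0"
    using blinfun.diff_right[of "proj_op N" u v] v by (simp add: app v_def orth_proj_ident[OF N(1)])
  have "A x = 0" "A v = 0" using x(1) v by (simp_all add: N_def op_ker_def)
  moreover have "orth_proj N x = x" using x(1) by (simp add: orth_proj_ident[OF N(1)] N_def[symmetric])
  ultimately have "?T x = ?T (u - v)" using u Pv by (simp only: T_app) (simp add: blinfun.diff_right)
  moreover have "G (?T z) = z" for z
  proof -
    have "G (?T z) = (G o\<^sub>L ?T) z" by (simp only: blinfun_apply_blinfun_compose)
    also have "\<dots> = z" using G by (simp add: is_op_inverse_def N_def)
    finally show ?thesis .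
  qed
  ultimately have "x = u - v" by metis
  then show "x = 0" using Pv x(1) by (simp add: orth_proj_ident[OF N(1)] N_def[symmetric])
qed

section \<open>Characterizations of a simple pole\<close>

theorem theorem3p2:
  fixes p :: nat
    and \<phi> :: "nat \<Rightarrow> 'a::chilbert_space \<Rightarrow>\<^sub>L 'a"
    and \<Phi> :: "complex \<Rightarrow> 'a \<Rightarrow>\<^sub>L 'a"
    and \<Pi>0 \<Pi>1 :: "'a \<Rightarrow>\<^sub>L 'a"
    and \<alpha>1 \<beta>1 :: "'a set"
    and \<Lambda>1 :: "'a \<Rightarrow> 'a"
  assumes separable: "separable_space (euclidean :: 'a topology)"
    and p: "p \<ge> 1"
    and linear: "\<And>j. j \<in> {1..p} \<Longrightarrow> \<phi> j \<in> cops"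
    and compact: "\<And>j. j \<in> {1..p} \<Longrightarrow> compact_op (\<phi> j)"
    and \<Phi>: "\<Phi> = pencil p \<phi>"
    and noninvertible: "\<not> op_invertible (\<Phi> 1)"
    and invertible: "\<And>z. z \<in> cball 0 1 \<Longrightarrow> z \<noteq> 1 \<Longrightarrow> op_invertible (\<Phi> z)"
    and \<Pi>0: "\<Pi>0 = \<Phi> 1"
    and \<Pi>1: "\<Pi>1 = op_deriv \<Phi> 1"
    and \<alpha>1: "\<alpha>1 = op_ran \<Pi>0"
    and \<beta>1: "\<beta>1 = orth_compl (op_ker \<Pi>0)"
    and \<Lambda>1: "\<Lambda>1 = (\<lambda>x. orth_proj (orth_compl \<alpha>1) (blinfun_apply \<Pi>1 x))"
  shows "(inverse_has_pole \<Phi> 1 1 \<longleftrightarrow> bij_betw \<Lambda>1 (orth_compl \<beta>1) (orth_compl \<alpha>1))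
    \<and> (bij_betw \<Lambda>1 (orth_compl \<beta>1) (orth_compl \<alpha>1)
        \<longleftrightarrow> direct_sum \<alpha>1 (blinfun_apply \<Pi>1 ` orth_compl \<beta>1))
    \<and> (direct_sum \<alpha>1 (blinfun_apply \<Pi>1 ` orth_compl \<beta>1)
        \<longleftrightarrow> \<alpha>1 + blinfun_apply \<Pi>1 ` orth_compl \<beta>1 = UNIV)
    \<and> (\<forall>\<Upsilon>. inverse_laurent \<Phi> 1 1 \<Upsilon> \<longrightarrow>
        blinfun_apply (\<Upsilon> (-1))
          = (\<lambda>x. inv_into (orth_compl \<beta>1) \<Lambda>1 (orth_proj (orth_compl \<alpha>1) x)))"
proof -
  define A where "A = pencil_coeff p \<phi>"
  have A: "A i \<in> cops" "i > p \<Longrightarrow> A i = 0" for i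
    unfolding A_def by (rule pencil_coeff_in_cops[OF linear], assumption) (rule pencil_coeff_eq_0)
  have taylor: "\<Phi> (1 + w) = (\<Sum>i\<le>p. scaleC_op (w ^ i) (A i))" for w
    unfolding \<Phi> A_def by (rule pencil_taylor)
  have A0: "A 0 = \<Pi>0" by (simp add: A_def \<Pi>0 \<Phi> pencil_coeff_0)
  have A1: "A 1 = \<Pi>1" by (simp only: A_def \<Pi>1 \<Phi> op_deriv_pencil)
  have \<Pi>: "\<Pi>0 \<in> cops" "\<Pi>1 \<in> cops" using A(1) A0 A1 by metis+
  have K: "seq_compact_op (id_blinfun - \<Pi>0)" "seq_compact_op \<Pi>1"
    using seq_compact_op_pencil_coeff[OF compact_op_imp_seq_compact_op[OF compact]] A0 A1
    by (auto simp: A_def)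
  define N where "N = op_ker \<Pi>0"
  have N: "csubspace N" "closed N" by (simp_all add: N_def csubspace_op_ker \<Pi> closed_op_ker)
  have \<beta>: "orth_compl \<beta>1 = N" unfolding \<beta>1 N_def[symmetric] by (rule orth_compl_orth_compl[OF N])
  have \<alpha>: "csubspace \<alpha>1" "closed \<alpha>1"
    unfolding \<alpha>1 by (intro csubspace_op_ran closed_range_compact_perturbation \<Pi> K)+
  define P where "P = proj_op N"
  have P_app: "blinfun_apply P = orth_proj N" unfolding P_def by (rule proj_op_apply[OF N])
  let ?sum = "\<alpha>1 + blinfun_apply \<Pi>1 ` N = UNIV"
  let ?inv = "\<exists>G. is_op_inverse (\<Pi>0 + (\<Pi>1 o\<^sub>L P)) G"
  have \<Lambda>_eq: "\<Lambda>1 x = orth_proj (orth_compl \<alpha>1) y \<longleftrightarrow> \<Pi>1 x - y \<in> \<alpha>1" for x y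
    unfolding \<Lambda>1 by (rule orth_proj_orth_compl_eq_iff[OF \<alpha>])
  have Proj_\<alpha>: "orth_proj (orth_compl \<alpha>1) y = y" if "y \<in> orth_compl \<alpha>1" for y
    using that by (rule orth_proj_ident[OF csubspace_orth_compl])

  have residue_eqs: "\<Pi>0 (\<Upsilon> (- 1) x) = 0" "\<Pi>0 (\<Upsilon> 0 x) + \<Pi>1 (\<Upsilon> (- 1) x) = x"
    if "inverse_laurent \<Phi> 1 1 \<Upsilon>" for \<Upsilon> x
  proof -
    note c = simple_pole_imp_coefficient_equations[where A = A and m = p, OF A taylor that, unfolded A0 A1]
    show "\<Pi>0 (\<Upsilon> (- 1) x) = 0"
      using arg_cong[OF c(1), of "\<lambda>T. blinfun_apply T x"] by simp
    show "\<Pi>0 (\<Upsilon> 0 x) + \<Pi>1 (\<Upsilon> (- 1) x) = x"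
      using arg_cong[OF c(2), of "\<lambda>T. blinfun_apply T x"] by (simp add: blinfun.add_left)
  qed
  have pole_sum: ?sum if pole: "inverse_has_pole \<Phi> 1 1"
  proof -
    obtain \<Upsilon> where \<Upsilon>: "inverse_laurent \<Phi> 1 1 \<Upsilon>"
      using pole unfolding inverse_has_pole_def by blast
    have "x \<in> \<alpha>1 + blinfun_apply \<Pi>1 ` N" for x
    proof -
      have "\<Pi>0 (\<Upsilon> 0 x) + \<Pi>1 (\<Upsilon> (- 1) x) \<in> \<alpha>1 + blinfun_apply \<Pi>1 ` N"
        using residue_eqs(1)[OF \<Upsilon>]
        by (intro set_plus_intro) (auto simp: \<alpha>1 op_ran_def N_def op_ker_def)
      then show ?thesis by (simp only: residue_eqs(2)[OF \<Upsilon>])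
    qed
    then show ?thesis by blast
  qed
  have sum_inv: ?inv if ?sum
    using ran_plus_image_ker_imp_inverse[OF \<Pi>(1) K(1) \<Pi>(2) K(2)] that
    unfolding \<alpha>1 N_def P_def by metis
  have inv_pole: "inverse_has_pole \<Phi> 1 1" if inv: ?inv
  proof -
    obtain G where G: "is_op_inverse (\<Pi>0 + (\<Pi>1 o\<^sub>L P)) G" using inv by blast
    have P: "P \<in> cops" unfolding P_def by (rule proj_op_in_cops[OF N])
    have PP: "P o\<^sub>L P = P"
      by (rule blinfun_eqI) (simp add: P_app orth_proj_ident[OF N(1)] orth_proj_in(1)[OF N])
    have AP: "A 0 o\<^sub>L P = 0"
      using orth_proj_in(1)[OF N] by (intro blinfun_eqI) (simp add: A0 P_app N_def op_ker_def)
    have P0: "P \<noteq> 0"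
    proof
      assume "P = 0"
      then have "is_op_inverse (\<Phi> 1) G" using G by (simp add: \<Pi>0)
      then show False using noninvertible by (auto simp: op_invertible_def)
    qed
    have G': "is_op_inverse (A 0 + (A 1 o\<^sub>L P)) G" using G by (simp only: A0 A1)
    show ?thesis
      by (rule simple_pole_if_invertible[where A = A and m = p, OF A taylor P PP AP P0 G'])
  qed
  have sum_trivial: "x = 0" if ?sum "x \<in> N" "\<Pi>1 x \<in> \<alpha>1" for x
    using sum_inv[OF that(1)] inverse_imp_ker_Int_vimage_ran_trivial[OF \<Pi>(1), of \<Pi>1] that(2,3)
    unfolding N_def P_def \<alpha>1 by blast
  have sum_bij: "bij_betw \<Lambda>1 N (orth_compl \<alpha>1)" if s: ?sum
    unfolding bij_betw_def
  proof
    show "inj_on \<Lambda>1 N"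
    proof (rule inj_onI)
      fix x y assume xy: "x \<in> N" "y \<in> N" "\<Lambda>1 x = \<Lambda>1 y"
      then have "\<Pi>1 x - \<Pi>1 y \<in> \<alpha>1" using \<Lambda>_eq[of x "\<Pi>1 y"] by (simp add: \<Lambda>1)
      then have "x - y = 0"
        using xy by (intro sum_trivial[OF s] csubspaceD(4)[OF N(1)]) (auto simp: blinfun.diff_right)
      then show "x = y" by simp
    qed
    show "\<Lambda>1 ` N = orth_compl \<alpha>1"
    proof
      show "\<Lambda>1 ` N \<subseteq> orth_compl \<alpha>1" unfolding \<Lambda>1 using orth_proj_orth_compl_in[OF \<alpha>] by blast
      show "orth_compl \<alpha>1 \<subseteq> \<Lambda>1 ` N"
      proof
        fix y assume y: "y \<in> orth_compl \<alpha>1"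
        have "y \<in> \<alpha>1 + blinfun_apply \<Pi>1 ` N" using s by simp
        then obtain a n where an: "y = a + \<Pi>1 n" "a \<in> \<alpha>1" "n \<in> N" by (auto simp: set_plus_def)
        have "0 - a \<in> \<alpha>1" by (intro csubspaceD(1,4)[OF \<alpha>(1)] an)
        then have "\<Lambda>1 n = orth_proj (orth_compl \<alpha>1) y" by (simp add: \<Lambda>_eq an)
        then show "y \<in> \<Lambda>1 ` N" using Proj_\<alpha>[OF y] an(3) by auto
      qed
    qed
  qed
  have bij_sum: ?sum if bij: "bij_betw \<Lambda>1 N (orth_compl \<alpha>1)"
  proof -
    have "h \<in> \<alpha>1 + blinfun_apply \<Pi>1 ` N" for h
    proof -
      obtain n where n: "n \<in> N" "\<Lambda>1 n = orth_proj (orth_compl \<alpha>1) h"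
        using bij orth_proj_orth_compl_in[OF \<alpha>, of h] unfolding bij_betw_def by (metis imageE)
      then have "\<Pi>1 n - h \<in> \<alpha>1" using \<Lambda>_eq by blast
      then have "0 - (\<Pi>1 n - h) \<in> \<alpha>1" by (rule csubspaceD(4)[OF \<alpha>(1) csubspaceD(1)[OF \<alpha>(1)]])
      then have "(h - \<Pi>1 n) + \<Pi>1 n \<in> \<alpha>1 + blinfun_apply \<Pi>1 ` N"
        using n(1) by (intro set_plus_intro) auto
      then show ?thesis by simp
    qed
    then show ?thesis by blast
  qed
  have sum_direct: "direct_sum \<alpha>1 (blinfun_apply \<Pi>1 ` N)" if s: ?sum
  proof -
    have "y = 0" if y: "y \<in> \<alpha>1" "y \<in> blinfun_apply \<Pi>1 ` N" for y
    proof -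
      obtain x where "x \<in> N" "y = \<Pi>1 x" using y(2) by blast
      then show ?thesis using sum_trivial[OF s, of x] y(1) by (simp add: blinfun.zero_right)
    qed
    moreover have "0 \<in> \<alpha>1" "0 \<in> blinfun_apply \<Pi>1 ` N"
      using csubspaceD(1)[OF \<alpha>(1)] csubspaceD(1)[OF N(1)] by (auto intro!: image_eqI[of _ _ 0] simp: blinfun.zero_right)
    ultimately show ?thesis unfolding direct_sum_def using s by blast
  qed
  have direct_sum: ?sum if "direct_sum \<alpha>1 (blinfun_apply \<Pi>1 ` N)"
    using that by (simp add: direct_sum_def)
  have residue: "blinfun_apply (\<Upsilon> (- 1)) = (\<lambda>x. inv_into N \<Lambda>1 (orth_proj (orth_compl \<alpha>1) x))"
    if \<Upsilon>: "inverse_laurent \<Phi> 1 1 \<Upsilon>" for \<Upsilon>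
  proof
    fix x
    have "inj_on \<Lambda>1 N"
      using sum_bij[OF pole_sum] \<Upsilon> by (auto simp: inverse_has_pole_def bij_betw_def)
    moreover have "\<Upsilon> (- 1) x \<in> N" using residue_eqs(1)[OF \<Upsilon>] by (simp add: N_def op_ker_def)
    moreover have "\<Lambda>1 (\<Upsilon> (- 1) x) = orth_proj (orth_compl \<alpha>1) x"
    proof -
      have "\<Pi>1 (\<Upsilon> (- 1) x) - x = 0 - \<Pi>0 (\<Upsilon> 0 x)"
        using residue_eqs(2)[OF \<Upsilon>, of x] by (simp add: algebra_simps eq_neg_iff_add_eq_0)
      also have "\<dots> \<in> \<alpha>1"
        by (intro csubspaceD(1,4)[OF \<alpha>(1)]) (simp add: \<alpha>1 op_ran_def)
      finally show ?thesis by (simp only: \<Lambda>_eq)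
    qed
    ultimately show "\<Upsilon> (- 1) x = inv_into N \<Lambda>1 (orth_proj (orth_compl \<alpha>1) x)"
      by (metis inv_into_f_f)
  qed
  show ?thesis
    unfolding \<beta> using pole_sum sum_inv inv_pole sum_bij bij_sum sum_direct direct_sum residue by blast
qed

end
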